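(* Let $(W,S)$ be a Coxeter system with $S$ finite and root system $\Phi$, and let $n\in\mathbb N$. (1) $S\cup\{e\}\subseteq L_n(W)$. (2) The map $\Sigma_n:L_n(W)\to\Lambda_n(W)$, $w\mapsto\Sigma_n(w)$, is injective. (3) The set $L_n(W)$ is finite and closed under join, i.e., if $X\subseteq L_n(W)$ is bounded then $\bigvee X\in L_n(W)$.
   Context: Here $\mathbb N=\{0,1,2,\dots\}$ and $e$ is the identity of $W$. Let $\ell$ be the length function of $(W,S)$. The (right) weak order on $W$ is $u\leq_R w$ iff $\ell(w)=\ell(u)+\ell(u^{-1}w)$. A subset $X\subseteq W$ is bounded if there is $g\in W$ with $x\leq_R g$ for all $x\in X$; every bounded $X$ has a least upper bound $\bigvee X$ for $\leq_R$, called its join. Geometric representation and roots. Fix a geometric representation of $(W,S)$: a real vector space $V$ with a symmetric bilinear form $B$, and a simple system $\Delta=\{\alpha_s : s\in S\}\subseteq V$ (finite, indexed bijectively by $S$) such that: $\sum_{\alpha\in\Delta}a_\alpha\alpha=0$ with all $a_\alpha\ge 0$ implies all $a_\alpha=0$; $B(\alpha,\beta)\in\,]-\infty,-1]\cup\{-\cos(\pi/k): k\in\mathbb N, k\geq 2\}$ for distinct $\alpha,\beta\in\Delta$; $B(\alpha,\alpha)=1$ for $\alpha\in\Delta$; and $W$ is faithfully represented in the group of linear maps preserving $B$, with $s\in S$ acting by $v\mapsto v-2B(\alpha_s,v)\alpha_s$. (So $B(\alpha_s,\alpha_t)=-\cos(\pi/m_{st})$ if the order $m_{st}$ of $st$ is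 finite, and $B(\alpha_s,\alpha_t)\le -1$ iff $m_{st}=\infty$.) For $A\subseteq V$, $\operatorname{cone}(A)$ is the set of non-negative linear combinations of vectors of $A$. The root system is $\Phi=W(\Delta)$, with positive roots $\Phi^+=\operatorname{cone}(\Delta)\cap\Phi$ and negative roots $\Phi^-=-\Phi^+$; $\Phi=\Phi^+\sqcup\Phi^-$. Put $\operatorname{cone}_\Phi(A)=\operatorname{cone}(A)\cap\Phi$. The (left) inversion set of $w\in W$ is $N(w)=\Phi^+\cap w(\Phi^-)$. $n$-small roots, $n$-small inversion sets, $n$-low elements. For $\alpha,\beta\in\Phi^+$, write $\alpha\preceq\beta$ if for all $w\in W$, $\beta\in N(w)$ implies $\alpha\in N(w)$; write $\alpha\prec\beta$ if moreover $\alpha\neq\beta$. The $\infty$-depth of $\beta\in\Phi^+$ is $\operatorname{dp}_\infty(\beta)=|\{\alpha\in\Phi^+ : \alpha\prec\beta\}|$, and $\Sigma_n=\{\beta\in\Phi^+:\operatorname{dp}_\infty(\beta)\le n\}$ is the set of $n$-small roots. For $w\in W$, $\Sigma_n(w)=N(w)\cap\Sigma_n$, and $\Lambda_n(W)=\{\Sigma_n(w): w\in W\}$. An element $w\in W$ is $n$-low if $N(w)=\operatorname{cone}_\Phi(A)$ for some $A\subseteq\Sigma_n$ (equivalently $N(w)=\operatorname{cone}_\Phi(\Sigma_n(w))$); $L_n(W)$ is the set of $n$-low elements. *)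

theory Defs
  imports
    "HOL-Analysis.Analysis"
    "HOL-Algebra.Multiplicative_Group"
    "HOL-Library.Extended_Nat"
begin

section \<open>Coxeter systems\<close>

definition word_prod :: "('w, 'm) monoid_scheme \<Rightarrow> 'w list \<Rightarrow> 'w" where
  "word_prod W ws = foldr (\<otimes>\<^bsub>W\<^esub>) ws \<one>\<^bsub>W\<^esub>"

text \<open>
  The congruence on words over \<open>S\<close> generated by the relators \<open>(s t)\<^sup>m = 1\<close>, where \<open>m\<close> is the
  order of \<open>s t\<close>.  Infinite order is encoded as \<open>0\<close>, for which the rule only says that a word
  is congruent to itself.  The case \<open>s = t\<close> gives \<open>s s = 1\<close>, so that every letter is
  its own formal inverse: the quotient of the free monoid on \<open>S\<close> by this congruence is the group
  presented by the generators \<open>S\<close> and these relators.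
\<close>
inductive coxeter_cong ::
    "('w, 'm) monoid_scheme \<Rightarrow> 'w set \<Rightarrow> 'w list \<Rightarrow> 'w list \<Rightarrow> bool" for W S where
  relator: "\<lbrakk>us \<in> lists S; vs \<in> lists S; s \<in> S; t \<in> S\<rbrakk> \<Longrightarrow>
     coxeter_cong W S (us @ concat (replicate (group.ord W (s \<otimes>\<^bsub>W\<^esub> t)) [s, t]) @ vs) (us @ vs)"
| refl: "us \<in> lists S \<Longrightarrow> coxeter_cong W S us us"
| sym: "coxeter_cong W S us vs \<Longrightarrow> coxeter_cong W S vs us"
| trans: "\<lbrakk>coxeter_cong W S us vs; coxeter_cong W S vs ws\<rbrakk> \<Longrightarrow> coxeter_cong W S us ws"

locale coxeter_system = group W for W (structure) +
  fixes S :: "'a set"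
  assumes generators: "S \<subseteq> carrier W" "generate W S = carrier W"
    and involutions: "\<And>s. s \<in> S \<Longrightarrow> ord s = 2"
    and presentation: "\<And>us vs. \<lbrakk>us \<in> lists S; vs \<in> lists S; word_prod W us = word_prod W vs\<rbrakk>
          \<Longrightarrow> coxeter_cong W S us vs"
begin

definition len :: "'a \<Rightarrow> nat" where
  "len w = (LEAST k. \<exists>ws \<in> lists S. length ws = k \<and> word_prod W ws = w)"

definition weak_order :: "'a gorder" where
  "weak_order = \<lparr>carrier = carrier W, eq = (=),
     le = (\<lambda>u w. len w = len u + len (inv u \<otimes> w))\<rparr>"

definition weakly_bounded :: "'a set \<Rightarrow> bool" where
  "weakly_bounded X \<longleftrightarrow> X \<subseteq> carrier W \<and> (\<exists>g \<in> carrier W. \<forall>x \<in> X. x \<sqsubseteq>\<^bsub>weak_order\<^esub> g)"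

end


section \<open>Geometric representations\<close>

text \<open>The empty combination is included, so that \<open>nonneg_cone {} = {0}\<close>.\<close>
definition nonneg_cone :: "'v::real_vector set \<Rightarrow> 'v set" where
  "nonneg_cone A =
     {\<Sum>v\<in>F. c v *\<^sub>R v | F c. finite F \<and> F \<subseteq> A \<and> (\<forall>v\<in>F. (c v :: real) \<ge> 0)}"

definition isometry_group :: "('v::real_vector \<Rightarrow> 'v \<Rightarrow> real) \<Rightarrow> ('v \<Rightarrow> 'v) monoid" where
  "isometry_group B =
     \<lparr>carrier = {f. linear f \<and> bij f \<and> (\<forall>u v. B (f u) (f v) = B u v)}, mult = (\<circ>), one = id\<rparr>"

text \<open>
  The simple root of \<open>s\<close> is \<open>\<alpha> s\<close>, and \<open>\<rho>\<close> is the representation of \<open>W\<close> on \<open>V\<close>,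
  the whole type \<open>'v\<close>.
\<close>
locale geometric_representation = coxeter_system W S
  for W (structure) and S :: "'a set" +
  fixes B :: "'v::real_vector \<Rightarrow> 'v \<Rightarrow> real"
    and \<alpha> :: "'a \<Rightarrow> 'v"
    and \<rho> :: "'a \<Rightarrow> 'v \<Rightarrow> 'v"
  assumes form: "bilinear B" "\<And>u v. B u v = B v u"
    and simple_finite: "finite (\<alpha> ` S)"
    and simple_inj: "inj_on \<alpha> S"
    and simple_positively_independent:
      "\<And>a :: 'v \<Rightarrow> real. \<lbrakk>\<And>\<delta>. \<delta> \<in> \<alpha> ` S \<Longrightarrow> a \<delta> \<ge> 0; (\<Sum>\<delta>\<in>\<alpha> ` S. a \<delta> *\<^sub>R \<delta>) = 0\<rbrakk>
         \<Longrightarrow> \<forall>\<delta>\<in>\<alpha> ` S. a \<delta> = 0"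
    and form_distinct: "\<And>\<beta> \<gamma>. \<lbrakk>\<beta> \<in> \<alpha> ` S; \<gamma> \<in> \<alpha> ` S; \<beta> \<noteq> \<gamma>\<rbrakk>
         \<Longrightarrow> B \<beta> \<gamma> \<in> {..-1} \<union> {- cos (pi / real k) | k :: nat. k \<ge> 2}"
    and form_unit: "\<And>\<beta>. \<beta> \<in> \<alpha> ` S \<Longrightarrow> B \<beta> \<beta> = 1"
    and faithful: "\<rho> \<in> mon W (isometry_group B)"
    and reflection: "\<And>s v. s \<in> S \<Longrightarrow> \<rho> s v = v - (2 * B (\<alpha> s) v) *\<^sub>R \<alpha> s"
begin

definition roots :: "'v set" where
  "roots = (\<Union>w \<in> carrier W. \<rho> w ` \<alpha> ` S)"

definition pos_roots :: "'v set" where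
  "pos_roots = nonneg_cone (\<alpha> ` S) \<inter> roots"

definition neg_roots :: "'v set" where
  "neg_roots = uminus ` pos_roots"

definition root_cone :: "'v set \<Rightarrow> 'v set" where
  "root_cone A = nonneg_cone A \<inter> roots"

definition inversions :: "'a \<Rightarrow> 'v set" where
  "inversions w = pos_roots \<inter> \<rho> w ` neg_roots"

definition dominance :: "'v \<Rightarrow> 'v \<Rightarrow> bool" where
  "dominance \<beta> \<gamma> \<longleftrightarrow> \<beta> \<in> pos_roots \<and> \<gamma> \<in> pos_roots \<and>
     (\<forall>w \<in> carrier W. \<gamma> \<in> inversions w \<longrightarrow> \<beta> \<in> inversions w)"

text \<open>Valued in \<open>enat\<close> because \<open>card\<close> is \<open>0\<close> on infinite sets.\<close>
definition inf_depth :: "'v \<Rightarrow> enat" where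
  "inf_depth \<gamma> = (let D = {\<beta> \<in> pos_roots. dominance \<beta> \<gamma> \<and> \<beta> \<noteq> \<gamma>}
     in if finite D then enat (card D) else \<infinity>)"

definition small_roots :: "nat \<Rightarrow> 'v set" where
  "small_roots n = {\<beta> \<in> pos_roots. inf_depth \<beta> \<le> enat n}"

definition small_inversions :: "nat \<Rightarrow> 'a \<Rightarrow> 'v set" where
  "small_inversions n w = inversions w \<inter> small_roots n"

definition small_inversion_sets :: "nat \<Rightarrow> 'v set set" where
  "small_inversion_sets n = small_inversions n ` carrier W"

definition low_elements :: "nat \<Rightarrow> 'a set" where
  "low_elements n = {w \<in> carrier W. \<exists>A \<subseteq> small_roots n. inversions w = root_cone A}"

end

end

theory Submission
  imports Defs
begin

text \<open>
An element \<open>w\<close> is determined by its inversion set \<open>N(w)\<close>, and inversion sets are convex: a root in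
the cone over \<open>N(w)\<close> lies in \<open>N(w)\<close>.  Hence for an \<open>n\<close>-low \<open>w\<close> the set \<open>N(w)\<close> is the root cone of
\<open>\<Sigma>\<^sub>n(w)\<close>, which gives injectivity of \<open>w \<mapsto> \<Sigma>\<^sub>n(w)\<close> at once.  Two deeper facts remain: the
set \<open>\<Sigma>\<^sub>n\<close> of \<open>n\<close>-small roots is finite, so that there are finitely many possible \<open>\<Sigma>\<^sub>n(w)\<close>, and the
inversion set of the join of a bounded set \<open>X\<close> is the root cone of the union of the \<open>N(x)\<close>, so
that a join of elements whose inversion sets are cones over \<open>n\<close>-small roots is again of this kind.

All this rests on \<open>\<Phi> = \<Phi>\<^sup>+ \<squnion> \<Phi>\<^sup>-\<close>, which follows from \<open>length_increase_positive\<close>: if \<open>w s\<close> is longer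
than \<open>w\<close>, then \<open>w\<close> maps \<open>\<alpha>\<^sub>s\<close> to a positive root.  The proof splits off a maximal alternating suffix in
two generators, whose action on the two simple roots is given by Chebyshev polynomials.  It follows
that the weak order is inclusion of inversion sets.

Joins (\<open>inversions_join\<close>).  For two elements \<open>x\<close>, \<open>y\<close> below \<open>g\<close>, induct on the length of \<open>g\<close>.  If
\<open>x\<close> and \<open>y\<close> have a common first letter \<open>s\<close>, cancel it in \<open>x\<close>, \<open>y\<close> and \<open>g\<close>.  If they begin with
\<open>s \<noteq> t\<close>, then the positive roots in the plane of \<open>\<alpha>\<^sub>s\<close> and \<open>\<alpha>\<^sub>t\<close> all are inversions of \<open>g\<close> and form
the inversion set of an element \<open>u\<close> of the dihedral group \<open>\<langle>s, t\<rangle>\<close>.  Now \<open>x\<close> and \<open>u\<close> share the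
letter \<open>s\<close>, \<open>y\<close> and \<open>u\<close> share \<open>t\<close>, and the two joins so obtained share \<open>s\<close> again.

Finiteness of \<open>\<Sigma>\<^sub>n\<close>.  Let \<open>\<beta>\<close> dominate \<open>\<alpha> \<noteq> \<beta>\<close>, where \<open>\<alpha>\<close> is elementary, that is, dominates only
itself.  The reflection in \<open>\<alpha>\<close> maps \<open>\<beta>\<close> to a positive root which dominates fewer roots than \<open>\<beta>\<close>
(\<open>dominated_card_reflect\<close>), so that by induction on \<open>n\<close> it suffices to see that there are finitely many
elementary roots, the theorem of Brink and Howlett.  An elementary root that is not simple arises
from another one \<open>\<beta>\<close> by a simple reflection \<open>s\<close> with \<open>-1 < B(\<alpha>\<^sub>s, \<beta>) < 0\<close>, so it suffices to bound the
length of chains of such steps.  Record for each \<open>\<beta>\<close> in a chain the values \<open>B(\<alpha>\<^sub>t, \<beta>)\<close> which exceed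
\<open>-1\<close>.  A generator \<open>t\<close> whose value has dropped to \<open>-1\<close> or below can never act again, since
steps with other generators never raise its value.  If two members \<open>\<beta>\<close> and \<open>\<beta> + \<delta>\<close> of a chain had the same
record, then \<open>\<delta>\<close> would be a positive combination of simple roots orthogonal to it, hence isotropic,
and both roots being unit vectors would give \<open>B(\<beta>, \<beta> + \<delta>) = 1\<close>.  But two positive roots with form value
at least \<open>1\<close> are comparable for dominance.  So all records along a chain differ, and there are only
finitely many records because the form takes only finitely many values in \<open>]-1, 1[\<close> on pairs of
roots (\<open>finite_form_values\<close>): the reflections in such a pair generate a finite dihedral group, and a
functional that is averaged over this group and then moved into the fundamental chamber shows that the pair is conjugate
into a standard parabolic subsystem with finitely many roots.
\<close>

section \<open>Cones and positive functionals\<close>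

lemma nonneg_cone_base: "v \<in> A \<Longrightarrow> v \<in> nonneg_cone A"
  unfolding nonneg_cone_def
  by (rule CollectI, rule exI[of _ "{v}"], rule exI[of _ "\<lambda>_. 1"]) auto

lemma nonneg_cone_zero [simp]: "0 \<in> nonneg_cone A"
  unfolding nonneg_cone_def
  by (rule CollectI, rule exI[of _ "{}"], rule exI[of _ "\<lambda>_. 1"]) auto

lemma nonneg_cone_scale:
  assumes "x \<in> nonneg_cone A" "r \<ge> 0"
  shows "r *\<^sub>R x \<in> nonneg_cone A"
proof -
  obtain F c where F: "finite F" "F \<subseteq> A" "\<forall>v\<in>F. (c v :: real) \<ge> 0" "x = (\<Sum>v\<in>F. c v *\<^sub>R v)"
    using assms(1) unfolding nonneg_cone_def by blast
  then show ?thesis unfolding nonneg_cone_def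
    by (intro CollectI exI[of _ F] exI[of _ "\<lambda>v. r * c v"]) (auto simp: assms(2) scaleR_sum_right)
qed

lemma nonneg_cone_add:
  assumes "x \<in> nonneg_cone A" "y \<in> nonneg_cone A"
  shows "x + y \<in> nonneg_cone A"
proof -
  obtain F c where F: "finite F" "F \<subseteq> A" "\<forall>v\<in>F. (c v :: real) \<ge> 0" "x = (\<Sum>v\<in>F. c v *\<^sub>R v)"
    using assms(1) unfolding nonneg_cone_def by blast
  obtain G d where G: "finite G" "G \<subseteq> A" "\<forall>v\<in>G. (d v :: real) \<ge> 0" "y = (\<Sum>v\<in>G. d v *\<^sub>R v)"
    using assms(2) unfolding nonneg_cone_def by blast
  define e where "e v = (if v \<in> F then c v else 0) + (if v \<in> G then d v else 0)" for v
  have "x = (\<Sum>v\<in>F\<union>G. (if v \<in> F then c v else 0) *\<^sub>R v)"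
    unfolding F(4) by (rule sum.mono_neutral_cong_left) (use F G in auto)
  moreover have "y = (\<Sum>v\<in>F\<union>G. (if v \<in> G then d v else 0) *\<^sub>R v)"
    unfolding G(4) by (rule sum.mono_neutral_cong_left) (use F G in auto)
  ultimately have "x + y = (\<Sum>v\<in>F\<union>G. e v *\<^sub>R v)"
    by (simp add: e_def scaleR_left_distrib sum.distrib)
  then show ?thesis unfolding nonneg_cone_def
    using F G by (intro CollectI exI[of _ "F \<union> G"] exI[of _ e]) (auto simp: e_def)
qed

lemma nonneg_cone_sum:
  assumes "\<And>i. i \<in> I \<Longrightarrow> g i \<in> nonneg_cone A"
  shows "sum g I \<in> nonneg_cone A"
  using assms by (induct I rule: infinite_finite_induct) (auto intro: nonneg_cone_add)

text \<open>
This serves as the induction principle for cones: to show that all points of a cone have a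
property, it is enough that the property is closed under the cone operations.
\<close>
lemma nonneg_cone_least:
  assumes "A \<subseteq> T" "0 \<in> T" "\<And>x y. x \<in> T \<Longrightarrow> y \<in> T \<Longrightarrow> x + y \<in> T"
    "\<And>r x. x \<in> T \<Longrightarrow> r \<ge> 0 \<Longrightarrow> r *\<^sub>R x \<in> T"
  shows "nonneg_cone A \<subseteq> T"
proof
  fix x assume "x \<in> nonneg_cone A"
  then obtain F c where F: "finite F" "F \<subseteq> A" "\<forall>v\<in>F. (c v :: real) \<ge> 0" "x = (\<Sum>v\<in>F. c v *\<^sub>R v)"
    unfolding nonneg_cone_def by blast
  have "(\<Sum>v\<in>F. c v *\<^sub>R v) \<in> T" using F(1-3)
  proof (induct F rule: finite_induct)
    case (insert a F)
    then show ?case using assms by (simp add: subset_iff)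
  qed (simp add: assms)
  then show "x \<in> T" using F by simp
qed

lemma nonneg_cone_subset_cone: "A \<subseteq> nonneg_cone C \<Longrightarrow> nonneg_cone A \<subseteq> nonneg_cone C"
  by (rule nonneg_cone_least) (auto intro: nonneg_cone_add nonneg_cone_scale)

lemma nonneg_cone_mono: "A \<subseteq> C \<Longrightarrow> nonneg_cone A \<subseteq> nonneg_cone C"
  by (rule nonneg_cone_subset_cone) (auto intro: nonneg_cone_base)

lemma nonneg_cone_linear_image:
  assumes "linear f" "x \<in> nonneg_cone A" "f ` A \<subseteq> nonneg_cone C"
  shows "f x \<in> nonneg_cone C"
proof -
  have "nonneg_cone A \<subseteq> f -` nonneg_cone C"
    by (rule nonneg_cone_least)
      (use assms in \<open>auto simp: linear_0 linear_add linear_scale intro: nonneg_cone_add nonneg_cone_scale\<close>)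
  then show ?thesis using assms by auto
qed

lemma nonneg_cone_finite_image:
  assumes "finite I"
  shows "x \<in> nonneg_cone (f ` I) \<longleftrightarrow> (\<exists>c. (\<forall>i\<in>I. (c i :: real) \<ge> 0) \<and> x = (\<Sum>i\<in>I. c i *\<^sub>R f i))"
proof
  let ?T = "{x. \<exists>c. (\<forall>i\<in>I. (c i :: real) \<ge> 0) \<and> x = (\<Sum>i\<in>I. c i *\<^sub>R f i)}"
  have "nonneg_cone (f ` I) \<subseteq> ?T"
  proof (rule nonneg_cone_least)
    show "f ` I \<subseteq> ?T"
    proof (clarify)
      fix i assume "i \<in> I"
      then have "f i = (\<Sum>j\<in>I. (if j = i then 1 else 0) *\<^sub>R f j)"
        using assms by (simp add: if_distrib[of "\<lambda>r. r *\<^sub>R _"] cong: if_cong)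
      then show "\<exists>c. (\<forall>i\<in>I. (c i :: real) \<ge> 0) \<and> f i = (\<Sum>i\<in>I. c i *\<^sub>R f i)"
        by (intro exI[of _ "\<lambda>j. if j = i then 1 else 0"]) auto
    qed
    show "0 \<in> ?T" by (intro CollectI exI[of _ "\<lambda>_. 0"]) auto
    show "x + y \<in> ?T" if xy: "x \<in> ?T" "y \<in> ?T" for x y
    proof -
      obtain c where c: "\<forall>i\<in>I. (c i :: real) \<ge> 0" "x = (\<Sum>i\<in>I. c i *\<^sub>R f i)" using xy by auto
      obtain d where d: "\<forall>i\<in>I. (d i :: real) \<ge> 0" "y = (\<Sum>i\<in>I. d i *\<^sub>R f i)" using xy by auto
      show ?thesis using c d
        by (intro CollectI exI[of _ "\<lambda>i. c i + d i"]) (auto simp: scaleR_left_distrib sum.distrib)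
    qed
    show "r *\<^sub>R x \<in> ?T" if x: "x \<in> ?T" "r \<ge> 0" for r x
    proof -
      obtain c where c: "\<forall>i\<in>I. (c i :: real) \<ge> 0" "x = (\<Sum>i\<in>I. c i *\<^sub>R f i)" using x by auto
      show ?thesis using c x(2)
        by (intro CollectI exI[of _ "\<lambda>i. r * c i"]) (auto simp: scaleR_sum_right)
    qed
  qed
  then show "x \<in> nonneg_cone (f ` I) \<Longrightarrow> \<exists>c. (\<forall>i\<in>I. (c i :: real) \<ge> 0) \<and> x = (\<Sum>i\<in>I. c i *\<^sub>R f i)"
    by auto
next
  assume "\<exists>c. (\<forall>i\<in>I. (c i :: real) \<ge> 0) \<and> x = (\<Sum>i\<in>I. c i *\<^sub>R f i)"
  then obtain c where c: "\<forall>i\<in>I. (c i :: real) \<ge> 0" "x = (\<Sum>i\<in>I. c i *\<^sub>R f i)" by auto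
  show "x \<in> nonneg_cone (f ` I)"
    unfolding c(2) by (rule nonneg_cone_sum, rule nonneg_cone_scale, rule nonneg_cone_base) (use c in auto)
qed

text \<open>
The expressions are continuous in \<open>e\<close> and finitely many, so the signs at \<open>e = 0\<close> persist to the
right of \<open>0\<close>.
\<close>
lemma small_perturbation_positive:
  fixes x y :: "'i \<Rightarrow> real"
  assumes "finite I" "\<forall>i\<in>I. x i > 0"
  shows "\<exists>e>0. \<forall>i\<in>I. x i + e * y i > 0"
proof -
  have "\<forall>\<^sub>F e in at_right 0. x i + e * y i > 0" if "i \<in> I" for i
  proof (rule order_tendstoD)
    show "((\<lambda>e. x i + e * y i) \<longlongrightarrow> x i + 0 * y i) (at_right 0)" by (intro tendsto_intros)
  qed (use assms that in auto)
  then have "\<forall>\<^sub>F e in at_right 0. \<forall>i\<in>I. x i + e * y i > 0"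
    using assms(1) by (simp add: eventually_ball_finite)
  then have "\<forall>\<^sub>F e in at_right (0::real). e > 0 \<and> (\<forall>i\<in>I. x i + e * y i > 0)"
    using eventually_at_right_less by (rule eventually_conj[rotated])
  then show ?thesis using eventually_happens' trivial_limit_at_right_real by blast
qed

text \<open>
Gordan's theorem in an arbitrary real vector space, by induction on the number of vectors.  Remove one vector
\<open>a j\<close> and project along it.  Either the images of the others still satisfy the hypothesis; then a
functional for them, pulled back along the projection, vanishes on \<open>a j\<close> and can be tilted slightly
to become positive there.  Or some nonnegative combination of the others is a multiple of \<open>a j\<close>,
necessarily a positive one; then any functional that is positive on the others is positive on \<open>a j\<close>.
\<close>
lemma positive_functional_exists:
  fixes a :: "'i \<Rightarrow> 'v::real_vector"
  assumes "finite I"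
    and "\<And>c. (\<forall>i\<in>I. (c i :: real) \<ge> 0) \<Longrightarrow> (\<Sum>i\<in>I. c i *\<^sub>R a i) = 0 \<Longrightarrow> \<forall>i\<in>I. c i = 0"
  shows "\<exists>f :: 'v \<Rightarrow> real. linear f \<and> (\<forall>i\<in>I. f (a i) > 0)"
  using assms
proof (induct I arbitrary: a rule: finite_induct)
  case empty
  show ?case by (intro exI[of _ "\<lambda>_. 0"]) (simp add: linear_iff)
next
  case (insert j I)
  have sub: "\<forall>i\<in>I. c i = 0" if "\<forall>i\<in>I. (c i :: real) \<ge> 0" "(\<Sum>i\<in>I. c i *\<^sub>R a i) = 0" for c
  proof -
    have "(\<Sum>i\<in>insert j I. (c(j := 0)) i *\<^sub>R a i) = (\<Sum>i\<in>I. c i *\<^sub>R a i)"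
      using insert(1,2) by (auto intro!: sum.cong)
    then have "\<forall>i\<in>insert j I. (c(j := 0)) i = 0"
      using that by (intro insert(4)) auto
    then show ?thesis using insert(2) by (metis fun_upd_other insertCI)
  qed
  have "a j \<noteq> 0"
  proof
    assume "a j = 0"
    then have "\<forall>i\<in>insert j I. (if i = j then 1 else 0 :: real) = 0"
      using insert(1,2) by (intro insert(4)) (auto intro!: sum.neutral)
    then show False by auto
  qed
  then have "independent {a j}" by simp
  then obtain g :: "'v \<Rightarrow> real" where g: "linear g" "g (a j) = 1"
    using linear_independent_extend[of "{a j}" "\<lambda>_. 1"] by auto
  define p where "p v = v - g v *\<^sub>R a j" for v
  have p: "linear p"
    using g(1) by (intro linearI) (simp_all add: p_def linear_add linear_scale scaleR_left_distrib scaleR_right_diff_distrib)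
  have pj: "p (a j) = 0" by (simp add: p_def g)
  show ?case
  proof (cases "\<forall>c. (\<forall>i\<in>I. (c i :: real) \<ge> 0) \<longrightarrow> (\<Sum>i\<in>I. c i *\<^sub>R p (a i)) = 0 \<longrightarrow> (\<forall>i\<in>I. c i = 0)")
    case True
    then obtain f where f: "linear f" "\<forall>i\<in>I. (f (p (a i)) :: real) > 0"
      using insert(3)[of "\<lambda>i. p (a i)"] by blast
    \<comment> \<open>A small multiple of \<open>g\<close> makes the value at \<open>a j\<close> positive without spoiling the others.\<close>
    obtain e :: real where e: "e > 0" "\<forall>i\<in>I. f (p (a i)) + e * g (a i) > 0"
      using small_perturbation_positive[OF insert(1), of "\<lambda>i. f (p (a i))" "\<lambda>i. g (a i)"] f(2) by blast
    have "linear (\<lambda>v. f (p v) + e * g v)"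
      using f(1) p g(1) by (intro linearI) (simp_all add: linear_add linear_scale distrib_left)
    moreover have "f (p (a j)) + e * g (a j) > 0" using e f g pj by (simp add: linear_0)
    ultimately show ?thesis using e(2) by (intro exI[of _ "\<lambda>v. f (p v) + e * g v"]) auto
  next
    case False
    then obtain c where c: "\<forall>i\<in>I. (c i :: real) \<ge> 0" "(\<Sum>i\<in>I. c i *\<^sub>R p (a i)) = 0" "\<not> (\<forall>i\<in>I. c i = 0)"
      by auto
    define t where "t = g (\<Sum>i\<in>I. c i *\<^sub>R a i)"
    have "p (\<Sum>i\<in>I. c i *\<^sub>R a i) = 0" using c(2) p by (simp add: linear_sum linear_scale)
    then have t: "(\<Sum>i\<in>I. c i *\<^sub>R a i) = t *\<^sub>R a j" unfolding p_def t_def by simp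
    have "t > 0"
    proof (rule ccontr)
      assume "\<not> t > 0"
      have "(\<Sum>i\<in>insert j I. (c(j := - t)) i *\<^sub>R a i) = - t *\<^sub>R a j + (\<Sum>i\<in>I. c i *\<^sub>R a i)"
        using insert(1,2) by (auto intro!: sum.cong)
      also have "\<dots> = 0" using t by simp
      finally have "\<forall>i\<in>insert j I. (c(j := - t)) i = 0"
        using c(1) \<open>\<not> t > 0\<close> by (intro insert(4)) auto
      then show False using c(3) insert(2) by (metis fun_upd_other insertCI)
    qed
    obtain f where f: "linear f" "\<forall>i\<in>I. (f (a i) :: real) > 0"
      using insert(3)[of a] sub by blast
    have "t * f (a j) = (\<Sum>i\<in>I. c i * f (a i))"
      using arg_cong[OF t, of f] f(1) by (simp add: linear_sum linear_scale)
    also have "\<dots> > 0"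
    proof -
      obtain k where "k \<in> I" "c k \<noteq> 0" using c(3) by auto
      then show ?thesis using c(1) f(2) insert(1)
        by (intro sum_pos2[of I k]) (auto simp: less_eq_real_def intro!: mult_pos_pos)
    qed
    finally have "f (a j) > 0" using \<open>t > 0\<close> by (simp add: zero_less_mult_iff)
    then show ?thesis using f by (intro exI[of _ f]) auto
  qed
qed

section \<open>Words and lengths in Coxeter systems\<close>

context coxeter_system
begin

declare in_lists_conv_set [simp]

lemma gen_closed [simp]: "s \<in> S \<Longrightarrow> s \<in> carrier W"
  using generators by auto

lemma gen_square [simp]: "s \<in> S \<Longrightarrow> s \<otimes> s = \<one>"
  using involutions[of s] pow_ord_eq_1[of s] by (auto simp: numeral_2_eq_2)

lemma gen_inv [simp]: "s \<in> S \<Longrightarrow> inv s = s"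
  by (simp add: inv_equality)

lemma gen_cancel_left: "s \<in> S \<Longrightarrow> w \<in> carrier W \<Longrightarrow> s \<otimes> (s \<otimes> w) = w"
  by (simp add: m_assoc[symmetric])

lemma gen_cancel_right: "s \<in> S \<Longrightarrow> w \<in> carrier W \<Longrightarrow> w \<otimes> s \<otimes> s = w"
  by (simp add: m_assoc)

lemma word_prod_simps [simp]:
  "word_prod W [] = \<one>" "word_prod W (s # ws) = s \<otimes> word_prod W ws"
  by (simp_all add: word_prod_def)

lemma word_prod_closed [simp]: "\<forall>s\<in>set ws. s \<in> S \<Longrightarrow> word_prod W ws \<in> carrier W"
  by (induct ws) auto

lemma word_prod_append:
  "us \<in> lists S \<Longrightarrow> vs \<in> lists S \<Longrightarrow> word_prod W (us @ vs) = word_prod W us \<otimes> word_prod W vs"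
  by (induct us) (auto simp: m_assoc)

lemma word_prod_rev: "ws \<in> lists S \<Longrightarrow> word_prod W (rev ws) = inv (word_prod W ws)"
  by (induct ws) (auto simp: word_prod_append inv_mult_group)

lemma word_exists: "w \<in> carrier W \<Longrightarrow> \<exists>ws\<in>lists S. word_prod W ws = w"
proof -
  have "\<exists>ws\<in>lists S. word_prod W ws = w" if "w \<in> generate W S"
    using that
  proof induct
    case one show ?case by (rule bexI[of _ "[]"]) auto
  next
    case (incl h) then show ?case by (intro bexI[of _ "[h]"]) auto
  next
    case (inv h) then show ?case by (intro bexI[of _ "[h]"]) auto
  next
    case (eng g h)
    then obtain us vs where "us \<in> lists S" "word_prod W us = g" "vs \<in> lists S" "word_prod W vs = h" by auto
    then show ?case by (intro bexI[of _ "us @ vs"]) (auto simp: word_prod_append)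
  qed
  then show "w \<in> carrier W \<Longrightarrow> ?thesis" using generators by auto
qed

lemma reduced_word:
  assumes "w \<in> carrier W"
  obtains ws where "ws \<in> lists S" "word_prod W ws = w" "length ws = len w"
proof -
  have "\<exists>k. \<exists>ws\<in>lists S. length ws = k \<and> word_prod W ws = w"
    using word_exists[OF assms] by auto
  from LeastI_ex[OF this] show ?thesis using that unfolding len_def by auto
qed

lemma len_le: "ws \<in> lists S \<Longrightarrow> len (word_prod W ws) \<le> length ws"
  unfolding len_def by (rule Least_le) auto

lemma len_one [simp]: "len \<one> = 0"
  using len_le[of "[]"] by simp

lemma len_eq_0: "w \<in> carrier W \<Longrightarrow> len w = 0 \<longleftrightarrow> w = \<one>"
  by (rule reduced_word[of w]) auto

lemma len_mult_le:
  assumes "u \<in> carrier W" "v \<in> carrier W"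
  shows "len (u \<otimes> v) \<le> len u + len v"
proof -
  obtain us where us: "us \<in> lists S" "word_prod W us = u" "length us = len u"
    using reduced_word[OF assms(1)] .
  obtain vs where vs: "vs \<in> lists S" "word_prod W vs = v" "length vs = len v"
    using reduced_word[OF assms(2)] .
  show ?thesis using len_le[of "us @ vs"] us vs by (auto simp: word_prod_append)
qed

lemma len_gen_le: "s \<in> S \<Longrightarrow> len s \<le> 1"
  using len_le[of "[s]"] by simp

lemma len_inv [simp]: assumes "w \<in> carrier W" shows "len (inv w) = len w"
proof -
  have le: "len (inv u) \<le> len u" if u: "u \<in> carrier W" for u
  proof -
    obtain us where us: "us \<in> lists S" "word_prod W us = u" "length us = len u"
      using reduced_word[OF u] .
    show ?thesis using len_le[of "rev us"] us by (auto simp: word_prod_rev)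
  qed
  show ?thesis using le[OF assms] le[of "inv w"] assms by simp
qed

text \<open>
Relators have even length.  So the parity of a word depends on its product only, which makes
\<open>len w\<close> and \<open>len (w \<otimes> s)\<close> differ.
\<close>
lemma coxeter_cong_parity: "coxeter_cong W S us vs \<Longrightarrow> even (length us) = even (length vs)"
proof (induct rule: coxeter_cong.induct)
  case (relator us vs s t)
  have "length (concat (replicate n [s, t])) = 2 * n" for n by (induct n) auto
  then show ?case by simp
qed auto

lemma word_parity:
  assumes "ws \<in> lists S"
  shows "even (len (word_prod W ws)) = even (length ws)"
proof -
  obtain us where "us \<in> lists S" "word_prod W us = word_prod W ws" "length us = len (word_prod W ws)"
    using reduced_word[of "word_prod W ws"] assms by (metis in_lists_conv_set word_prod_closed)
  then show ?thesis using coxeter_cong_parity[OF presentation[of us ws]] assms by simp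
qed

lemma len_mult_gen:
  assumes "w \<in> carrier W" "s \<in> S"
  shows "len (w \<otimes> s) = Suc (len w) \<or> len w = Suc (len (w \<otimes> s))"
proof -
  obtain ws where ws: "ws \<in> lists S" "word_prod W ws = w" "length ws = len w"
    using reduced_word[OF assms(1)] .
  have "even (len (w \<otimes> s)) \<noteq> even (len w)"
    using word_parity[of "ws @ [s]"] ws assms by (simp add: word_prod_append)
  moreover have "len (w \<otimes> s) \<le> len w + 1"
    using len_mult_le[of w s] len_gen_le[of s] assms by auto
  moreover have "len w \<le> len (w \<otimes> s) + 1"
    using len_mult_le[of "w \<otimes> s" s] len_gen_le[of s] assms by (auto simp: gen_cancel_right)
  ultimately show ?thesis by presburger
qed

lemma last_letter:
  assumes "w \<in> carrier W" "w \<noteq> \<one>"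
  obtains t where "t \<in> S" "len w = Suc (len (w \<otimes> t))"
proof -
  obtain ws where ws: "ws \<in> lists S" "word_prod W ws = w" "length ws = len w"
    using reduced_word[OF assms(1)] .
  then have "ws \<noteq> []" using assms by auto
  then obtain us t where us: "ws = us @ [t]" by (metis rev_exhaust)
  then have t: "t \<in> S" "us \<in> lists S" using ws by auto
  then have "w \<otimes> t = word_prod W us" using ws(2) us by (auto simp: word_prod_append m_assoc)
  then have "len (w \<otimes> t) < len w" using len_le[OF t(2)] ws us by auto
  then show ?thesis using that[OF t(1)] len_mult_gen[OF assms(1) t(1)] by auto
qed

lemma len_gen_mult: 
  assumes "w \<in> carrier W" "s \<in> S"
  shows "len (s \<otimes> w) = len (inv w \<otimes> s)"
  using len_inv[of "inv w \<otimes> s"] assms by (simp add: inv_mult_group)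

lemma first_letter:
  assumes "w \<in> carrier W" "w \<noteq> \<one>"
  obtains s where "s \<in> S" "len w = Suc (len (s \<otimes> w))"
proof -
  have "inv w \<noteq> \<one>" using assms by (metis inv_inv inv_one)
  then obtain s where "s \<in> S" "len (inv w) = Suc (len (inv w \<otimes> s))"
    using last_letter[of "inv w"] assms by auto
  then show ?thesis using that[of s] assms by (simp add: len_gen_mult)
qed

lemma weak_order_simps [simp]:
  "carrier weak_order = carrier W"
  "u \<sqsubseteq>\<^bsub>weak_order\<^esub> w \<longleftrightarrow> len w = len u + len (inv u \<otimes> w)"
  by (simp_all add: weak_order_def)

end

section \<open>Positive and negative roots\<close>

text \<open>
Chebyshev polynomials of the second kind, shifted so that index \<open>k\<close> is the coefficient
\<open>sin (k \<theta>) / sin \<theta>\<close> for \<open>c = cos \<theta>\<close>.  They describe the roots of a dihedral group.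
\<close>
fun chebyshev :: "real \<Rightarrow> nat \<Rightarrow> real" where
  "chebyshev c 0 = 0"
| "chebyshev c (Suc 0) = 1"
| "chebyshev c (Suc (Suc k)) = 2 * c * chebyshev c (Suc k) - chebyshev c k"

lemma chebyshev_sin: "chebyshev (cos x) k * sin x = sin (real k * x)"
proof (induct "cos x" k rule: chebyshev.induct)
  case (3 k)
  have "sin (real (Suc (Suc k)) * x) = sin (real (Suc k) * x + x)"
    and "sin (real k * x) = sin (real (Suc k) * x - x)" by (simp_all add: algebra_simps)
  then have "sin (real (Suc (Suc k)) * x) = 2 * cos x * sin (real (Suc k) * x) - sin (real k * x)"
    by (simp only: sin_add sin_diff) (simp add: algebra_simps)
  with 3 show ?case by (simp add: algebra_simps)
qed auto

lemma chebyshev_cos_nonneg: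
  assumes "m \<ge> 2" "k \<le> m"
  shows "chebyshev (cos (pi / real m)) k \<ge> 0"
proof -
  define x where "x = pi / real m"
  have x: "0 < x" "x < pi" "real k * x \<le> pi" using assms by (auto simp: x_def field_simps)
  then have "chebyshev (cos x) k * sin x \<ge> 0" unfolding chebyshev_sin by (intro sin_ge_zero) auto
  moreover have "sin x > 0" using x by (intro sin_gt_zero)
  ultimately show ?thesis unfolding x_def[symmetric] by (simp add: zero_le_mult_iff)
qed

text \<open>
For \<open>c \<ge> 1\<close> the dihedral group is infinite, and the coefficients never become negative because they
increase.
\<close>
lemma chebyshev_ge_1:
  assumes "c \<ge> 1"
  shows "0 \<le> chebyshev c k \<and> chebyshev c k \<le> chebyshev c (Suc k)"
proof (induct k)
  case (Suc k)
  then have "2 * 1 * chebyshev c (Suc k) \<le> 2 * c * chebyshev c (Suc k)"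
    using assms by (intro mult_right_mono) auto
  with Suc show ?case by simp
qed simp

context geometric_representation
begin

abbreviation simple_cone :: "'v set" where "simple_cone \<equiv> nonneg_cone (\<alpha> ` S)"

lemma finite_gens [simp]: "finite S"
  using simple_finite simple_inj by (simp add: finite_image_iff)

lemma rho_linear: "w \<in> carrier W \<Longrightarrow> linear (\<rho> w)"
  and rho_form [simp]: "w \<in> carrier W \<Longrightarrow> B (\<rho> w u) (\<rho> w v) = B u v"
  using faithful unfolding mon_def hom_def isometry_group_def by auto

lemma rho_mult [simp]: "u \<in> carrier W \<Longrightarrow> v \<in> carrier W \<Longrightarrow> \<rho> (u \<otimes> v) x = \<rho> u (\<rho> v x)"
  using faithful unfolding mon_def hom_def isometry_group_def by auto

lemma rho_one [simp]: "\<rho> \<one> x = x"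
proof -
  have "bij (\<rho> \<one>)" using faithful unfolding mon_def hom_def isometry_group_def by auto
  moreover have "\<rho> \<one> (\<rho> \<one> x) = \<rho> \<one> x" using rho_mult[of \<one> \<one> x] by simp
  ultimately show ?thesis by (metis bij_pointE)
qed

lemma rho_inj: "u \<in> carrier W \<Longrightarrow> v \<in> carrier W \<Longrightarrow> (\<And>x. \<rho> u x = \<rho> v x) \<Longrightarrow> u = v"
  using faithful unfolding mon_def inj_on_def by blast

lemma rho_inv [simp]:
  assumes "w \<in> carrier W"
  shows "\<rho> (inv w) (\<rho> w x) = x" "\<rho> w (\<rho> (inv w) x) = x"
  using rho_mult[of "inv w" w x] rho_mult[of w "inv w" x] assms by (simp_all del: rho_mult)

lemma rho_eq_iff [simp]: "w \<in> carrier W \<Longrightarrow> \<rho> w x = \<rho> w y \<longleftrightarrow> x = y"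
  by (metis rho_inv(1))

lemma rho_gen_gen [simp]: "s \<in> S \<Longrightarrow> \<rho> s (\<rho> s x) = x"
  using rho_inv(1)[of s x] by simp

lemma form_simps:
  "B (x + y) z = B x z + B y z" "B z (x + y) = B z x + B z y"
  "B (x - y) z = B x z - B y z" "B z (x - y) = B z x - B z y"
  "B (r *\<^sub>R x) z = r * B x z" "B z (r *\<^sub>R x) = r * B z x"
  "B (- x) z = - B x z" "B z (- x) = - B z x" "B 0 z = 0" "B z 0 = 0"
  "B (sum f I) z = (\<Sum>i\<in>I. B (f i) z)" "B z (sum f I) = (\<Sum>i\<in>I. B z (f i))"
proof -
  have l: "linear (\<lambda>x. B x z)" "linear (B z)" for z using form(1) by (auto simp: bilinear_def)
  show "B (x + y) z = B x z + B y z" "B z (x + y) = B z x + B z y"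
    "B (x - y) z = B x z - B y z" "B z (x - y) = B z x - B z y"
    "B (r *\<^sub>R x) z = r * B x z" "B z (r *\<^sub>R x) = r * B z x"
    "B (- x) z = - B x z" "B z (- x) = - B z x" "B 0 z = 0" "B z 0 = 0"
    "B (sum f I) z = (\<Sum>i\<in>I. B (f i) z)" "B z (sum f I) = (\<Sum>i\<in>I. B z (f i))"
    using l by (simp_all add: linear_add[OF l(1)] linear_add[OF l(2)] linear_diff[OF l(1)]
      linear_diff[OF l(2)] linear_scale[OF l(1)] linear_scale[OF l(2)] linear_neg[OF l(1)]
      linear_neg[OF l(2)] linear_0[OF l(1)] linear_0[OF l(2)] linear_sum[OF l(1)] linear_sum[OF l(2)])
qed

lemma rho_simps:
  assumes "w \<in> carrier W"
  shows "\<rho> w (x + y) = \<rho> w x + \<rho> w y" "\<rho> w (x - y) = \<rho> w x - \<rho> w y"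
    "\<rho> w (r *\<^sub>R x) = r *\<^sub>R \<rho> w x" "\<rho> w (- x) = - \<rho> w x" "\<rho> w 0 = 0"
  using rho_linear[OF assms] by (simp_all add: linear_add linear_diff linear_scale linear_neg linear_0)

lemma simple_unit [simp]: "s \<in> S \<Longrightarrow> B (\<alpha> s) (\<alpha> s) = 1"
  using form_unit by blast

lemma simple_eq_iff [simp]: "s \<in> S \<Longrightarrow> t \<in> S \<Longrightarrow> \<alpha> s = \<alpha> t \<longleftrightarrow> s = t"
  using simple_inj by (auto simp: inj_on_def)

lemma rho_simple [simp]: "s \<in> S \<Longrightarrow> \<rho> s (\<alpha> s) = - \<alpha> s"
  by (simp add: reflection) (metis add_diff_cancel_left' diff_0 scaleR_2 diff_add_cancel minus_diff_eq)

lemma simple_form_cases: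
  assumes "s \<in> S" "t \<in> S" "s \<noteq> t"
  obtains "- B (\<alpha> s) (\<alpha> t) \<ge> 1" | m where "m \<ge> 2" "- B (\<alpha> s) (\<alpha> t) = cos (pi / real m)"
  using form_distinct[of "\<alpha> s" "\<alpha> t"] assms by auto

lemma simple_form_nonpos:
  assumes "s \<in> S" "t \<in> S" "s \<noteq> t"
  shows "B (\<alpha> s) (\<alpha> t) \<le> 0"
proof (cases rule: simple_form_cases[OF assms])
  case (2 m)
  have "cos (pi / real m) \<ge> 0"
    using 2(1) by (intro cos_ge_zero) (auto simp: field_simps intro: order_trans[of _ 0])
  then show ?thesis using 2(2) by simp
qed auto

lemma simple_cone_sum: "x \<in> simple_cone \<longleftrightarrow> (\<exists>c. (\<forall>s\<in>S. (c s :: real) \<ge> 0) \<and> x = (\<Sum>s\<in>S. c s *\<^sub>R \<alpha> s))"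
  by (rule nonneg_cone_finite_image) simp

lemma simple_in_cone [simp]: "s \<in> S \<Longrightarrow> \<alpha> s \<in> simple_cone"
  by (simp add: nonneg_cone_base)

lemma simple_independent:
  assumes "\<forall>s\<in>S. (c s :: real) \<ge> 0" "(\<Sum>s\<in>S. c s *\<^sub>R \<alpha> s) = 0"
  shows "\<forall>s\<in>S. c s = 0"
proof -
  let ?a = "\<lambda>d. c (inv_into S \<alpha> d)"
  have "(\<Sum>\<delta>\<in>\<alpha> ` S. ?a \<delta> *\<^sub>R \<delta>) = (\<Sum>s\<in>S. c s *\<^sub>R \<alpha> s)"
    by (subst sum.reindex[OF simple_inj]) (auto intro!: sum.cong simp: inv_into_f_f[OF simple_inj])
  then have "\<forall>\<delta>\<in>\<alpha> ` S. ?a \<delta> = 0"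
    using assms by (intro simple_positively_independent) (auto simp: inv_into_f_f[OF simple_inj])
  then show ?thesis by (auto simp: inv_into_f_f[OF simple_inj])
qed

lemma simple_cone_pointed:
  assumes "x \<in> simple_cone" "- x \<in> simple_cone"
  shows "x = 0"
proof -
  obtain c where c: "\<forall>s\<in>S. (c s :: real) \<ge> 0" "x = (\<Sum>s\<in>S. c s *\<^sub>R \<alpha> s)"
    using assms(1) simple_cone_sum by auto
  obtain d where d: "\<forall>s\<in>S. (d s :: real) \<ge> 0" "- x = (\<Sum>s\<in>S. d s *\<^sub>R \<alpha> s)"
    using assms(2) simple_cone_sum by auto
  have "(\<Sum>s\<in>S. (c s + d s) *\<^sub>R \<alpha> s) = x + - x"
    unfolding c(2) d(2)[unfolded c(2)] by (simp add: scaleR_left_distrib sum.distrib)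
  then have "\<forall>s\<in>S. c s + d s = 0" using c d by (intro simple_independent) auto
  then have "\<forall>s\<in>S. c s = 0" using c d by force
  then show ?thesis by (simp add: c(2))
qed

text \<open>
Simple roots may be linearly dependent, but each still spans an extremal ray of the
cone.  If \<open>x + y\<close> is \<open>r\<close> times \<open>\<alpha>\<^sub>s\<close>, apply \<open>B(\<alpha>\<^sub>s, _)\<close>: the other simple roots contribute nonpositive
values, so the coefficient of \<open>\<alpha>\<^sub>s\<close> in \<open>x + y\<close> is at least \<open>r\<close>, and positive independence makes all other
coefficients vanish.
\<close>
lemma simple_root_extremal:
  assumes "s \<in> S" "x \<in> simple_cone" "y \<in> simple_cone" "x + y = r *\<^sub>R \<alpha> s"
  shows "\<exists>c\<ge>0. x = c *\<^sub>R \<alpha> s"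
proof -
  obtain c where c: "\<forall>s\<in>S. (c s :: real) \<ge> 0" "x = (\<Sum>s\<in>S. c s *\<^sub>R \<alpha> s)"
    using assms(2) simple_cone_sum by auto
  obtain d where d: "\<forall>s\<in>S. (d s :: real) \<ge> 0" "y = (\<Sum>s\<in>S. d s *\<^sub>R \<alpha> s)"
    using assms(3) simple_cone_sum by auto
  define e where "e t = c t + d t" for t
  have split: "(\<Sum>t\<in>S. g t *\<^sub>R \<alpha> t) = g s *\<^sub>R \<alpha> s + (\<Sum>t\<in>S-{s}. g t *\<^sub>R \<alpha> t)" for g :: "'a \<Rightarrow> real"
    using assms(1) by (simp add: sum.remove)
  have e: "(\<Sum>t\<in>S. e t *\<^sub>R \<alpha> t) = r *\<^sub>R \<alpha> s"
    using c d assms(4) by (simp add: e_def scaleR_left_distrib sum.distrib)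
  have "B (\<alpha> s) (\<Sum>t\<in>S-{s}. e t *\<^sub>R \<alpha> t) \<le> 0"
    using c d assms(1) by (auto simp: form_simps e_def intro!: sum_nonpos mult_nonneg_nonpos simple_form_nonpos)
  moreover have "r *\<^sub>R \<alpha> s = e s *\<^sub>R \<alpha> s + (\<Sum>t\<in>S-{s}. e t *\<^sub>R \<alpha> t)" using e split by metis
  then have "B (\<alpha> s) (r *\<^sub>R \<alpha> s) = e s + B (\<alpha> s) (\<Sum>t\<in>S-{s}. e t *\<^sub>R \<alpha> t)"
    using assms(1) by (simp add: form_simps)
  ultimately have r: "e s - r \<ge> 0" using assms(1) by (simp add: form_simps)
  have "(\<Sum>t\<in>S. (e(s := e s - r)) t *\<^sub>R \<alpha> t) = (e s - r) *\<^sub>R \<alpha> s + (\<Sum>t\<in>S-{s}. e t *\<^sub>R \<alpha> t)"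
    by (subst split) simp
  also have "\<dots> = (e s *\<^sub>R \<alpha> s + (\<Sum>t\<in>S-{s}. e t *\<^sub>R \<alpha> t)) - r *\<^sub>R \<alpha> s"
    by (simp add: scaleR_left_diff_distrib)
  also have "\<dots> = 0" by (simp only: split[of e, symmetric] e diff_self)
  finally have "\<forall>t\<in>S. (e(s := e s - r)) t = 0" 
    using c d r by (intro simple_independent) (auto simp: e_def)
  then have "\<forall>t\<in>S-{s}. e t = 0" by (auto split: if_splits)
  then have "\<forall>t\<in>S-{s}. c t = 0" using c d by (force simp: e_def)
  then have "x = c s *\<^sub>R \<alpha> s" unfolding c(2) by (subst split) simp
  then show ?thesis using c assms(1) by auto
qed

text \<open>
Both sides act on \<open>V\<close> in the same way, because conjugating the reflection in \<open>\<alpha>\<^sub>s\<close> by \<open>w\<close> gives the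
reflection in \<open>w \<alpha>\<^sub>s\<close>; the representation is faithful.
\<close>
lemma reflection_conjugate:
  assumes "w \<in> carrier W" "s \<in> S" "p \<in> S" "\<rho> w (\<alpha> s) = \<alpha> p"
  shows "w \<otimes> s = p \<otimes> w"
proof (rule rho_inj)
  fix x
  have "B (\<alpha> p) (\<rho> w x) = B (\<alpha> s) x" using assms by (metis rho_form)
  then show "\<rho> (w \<otimes> s) x = \<rho> (p \<otimes> w) x"
    using assms by (simp add: reflection rho_simps)
qed (use assms in auto)

text \<open>
The alternating product of length \<open>k\<close> in \<open>s\<close> and \<open>t\<close> whose last letter is \<open>t\<close>.
\<close>
fun alternating :: "'a \<Rightarrow> 'a \<Rightarrow> nat \<Rightarrow> 'a" where
  "alternating s t 0 = \<one>"
| "alternating s t (Suc k) = (if even k then t else s) \<otimes> alternating s t k"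

lemma alternating_closed [simp]: "s \<in> S \<Longrightarrow> t \<in> S \<Longrightarrow> alternating s t k \<in> carrier W"
  by (induct k) auto

lemma rho_alternating:
  assumes "s \<in> S" "t \<in> S"
  defines "u \<equiv> chebyshev (- B (\<alpha> s) (\<alpha> t))"
  shows "\<rho> (alternating s t k) (\<alpha> s) =
    (if even k then u (Suc k) *\<^sub>R \<alpha> s + u k *\<^sub>R \<alpha> t else u (Suc k) *\<^sub>R \<alpha> t + u k *\<^sub>R \<alpha> s)"
proof (induct k)
  case 0
  then show ?case using assms by (simp add: u_def)
next
  case (Suc k)
  have u: "u (Suc (Suc k)) = 2 * (- B (\<alpha> s) (\<alpha> t)) * u (Suc k) - u k" by (simp add: u_def)
  have sym: "B (\<alpha> t) (\<alpha> s) = B (\<alpha> s) (\<alpha> t)" by (rule form)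
  have "r *\<^sub>R v + r *\<^sub>R v = (r * 2) *\<^sub>R v" for r and v :: 'v
    by (simp add: scaleR_left_distrib[symmetric])
  then show ?case using Suc assms(1,2) sym unfolding u
    by (auto simp: rho_simps reflection form_simps algebra_simps)
qed

lemma len_alternating:
  assumes "s \<in> S" "t \<in> S"
  shows "len (alternating s t k) \<le> k"
proof (induct k)
  case (Suc k)
  then show ?case
    using len_mult_le[of "if even k then t else s" "alternating s t k"] assms len_gen_le[of s] len_gen_le[of t]
    by (auto split: if_splits)
qed simp

lemma alternating_nonneg:
  assumes "s \<in> S" "t \<in> S"
    and nn: "chebyshev (- B (\<alpha> s) (\<alpha> t)) (Suc k) \<ge> 0" "chebyshev (- B (\<alpha> s) (\<alpha> t)) k \<ge> 0"
  shows "\<exists>p q. p \<ge> 0 \<and> q \<ge> 0 \<and> \<rho> (alternating s t k) (\<alpha> s) = p *\<^sub>R \<alpha> s + q *\<^sub>R \<alpha> t"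
  using rho_alternating[OF assms(1,2), of k] nn by (cases "even k") (force simp: add.commute)+

text \<open>
The braid relation read off from the geometry: for \<open>B(\<alpha>\<^sub>s, \<alpha>\<^sub>t) = -cos (\<pi>/m)\<close> the alternating
product of length \<open>m - 1\<close> maps \<open>\<alpha>\<^sub>s\<close> to a simple root, since \<open>sin \<pi> = 0\<close>.  So multiplying the
product of length \<open>m\<close> by \<open>s\<close> on the right removes its first letter.
\<close>
lemma alternating_shortens:
  assumes st: "s \<in> S" "t \<in> S" and m: "m \<ge> 2" "- B (\<alpha> s) (\<alpha> t) = cos (pi / real m)" and "m \<le> k"
  shows "len (alternating s t k \<otimes> s) < k"
  using \<open>m \<le> k\<close>
proof (induct k rule: dec_induct)
  define x where "x = pi / real m"
  obtain j where j: "m = Suc j" using m(1) by (cases m) auto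
  have x: "0 < x" "x < pi" using m(1) by (auto simp: x_def field_simps)
  then have sx: "sin x > 0" by (rule sin_gt_zero)
  have "chebyshev (cos x) (Suc j) * sin x = 0"
    unfolding chebyshev_sin j[symmetric] using m(1) by (simp add: x_def)
  then have u1: "chebyshev (cos x) (Suc j) = 0" using sx by simp
  have "chebyshev (cos x) j * sin x = sin x"
  proof -
    have "real j * x = pi - x" unfolding x_def using j by (simp add: field_simps)
    then show ?thesis unfolding chebyshev_sin by simp
  qed
  then have u0: "chebyshev (cos x) j = 1" using sx by simp
  define p where "p = (if even j then t else s)"
  have "\<rho> (alternating s t j) (\<alpha> s) = \<alpha> p"
    unfolding rho_alternating[OF st] m(2) x_def[symmetric] u0 u1 by (simp add: p_def)
  then have "alternating s t j \<otimes> s = p \<otimes> alternating s t j"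
    by (intro reflection_conjugate) (use st p_def in auto)
  also have "\<dots> = alternating s t m" by (simp add: j p_def)
  finally have "alternating s t m \<otimes> s = alternating s t j" using st by (metis gen_cancel_right alternating_closed)
  then show "len (alternating s t m \<otimes> s) < m" using len_alternating[OF st, of j] j by simp
next
  case (step n)
  have "len ((if even n then t else s) \<otimes> (alternating s t n \<otimes> s)) \<le> 1 + len (alternating s t n \<otimes> s)"
    using len_mult_le[of "if even n then t else s" "alternating s t n \<otimes> s"] st len_gen_le[of s] len_gen_le[of t]
    by (auto split: if_splits)
  then show ?case using step st by (auto simp: m_assoc split: if_splits)
qed

text \<open>
Write \<open>w\<close> as \<open>v\<close> times an alternating product in \<open>s\<close> and the last letter \<open>t\<close> of \<open>w\<close>, with lengths
adding up and the suffix as long as possible.  Then both \<open>v s\<close> and \<open>v t\<close> are longer than \<open>v\<close>, so by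
induction \<open>v\<close> maps \<open>\<alpha>\<^sub>s\<close> and \<open>\<alpha>\<^sub>t\<close> into the cone; and the suffix maps \<open>\<alpha>\<^sub>s\<close> to a nonnegative combination
of the two, for otherwise it would be so long that \<open>s\<close> shortens it.
\<close>
theorem length_increase_positive:
  assumes "w \<in> carrier W" "s \<in> S" "len w < len (w \<otimes> s)"
  shows "\<rho> w (\<alpha> s) \<in> simple_cone"
  using assms
proof (induct "len w" arbitrary: w s rule: less_induct)
  case less
  note w = less.prems(1) and s = less.prems(2)
  show ?case
  proof (cases "w = \<one>")
    case True
    then show ?thesis using s by simp
  next
    case False
    then obtain t where t: "t \<in> S" "len w = Suc (len (w \<otimes> t))" using last_letter w by blast
    have "s \<noteq> t" using t less.prems by auto
    let ?A = "alternating s t"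
    let ?P = "\<lambda>k. \<exists>v\<in>carrier W. w = v \<otimes> ?A k \<and> len w = len v + k"
    have "?P 1" using w t by (intro bexI[of _ "w \<otimes> t"]) (auto simp: gen_cancel_right)
    define k where "k = (GREATEST k. ?P k)"
    have Pk: "?P k" unfolding k_def using \<open>?P 1\<close> by (rule GreatestI_nat[where b = "len w"]) auto
    have max: "j \<le> k" if "?P j" for j
      unfolding k_def using that by (rule Greatest_le_nat[where b = "len w"]) auto
    have "k \<ge> 1" using max \<open>?P 1\<close> by blast
    then obtain j where j: "k = Suc j" by (cases k) auto
    obtain v where v: "v \<in> carrier W" "w = v \<otimes> ?A k" "len w = len v + k" using Pk by auto
    define r where "r = (if even j then t else s)"
    define r' where "r' = (if even k then t else s)"
    have r: "r \<in> S" "r' \<in> S" "{r, r'} = {s, t}" using s t j by (auto simp: r_def r'_def)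
    have Ar: "r \<otimes> ?A k = ?A j" using s t j by (simp add: r_def gen_cancel_left)
    have Ar': "r' \<otimes> ?A k = ?A (Suc k)" by (simp add: r'_def)
    \<comment> \<open>Otherwise \<open>w = (v r) \<cdot> (r \<cdot> suffix)\<close> would be a shorter expression for \<open>w\<close>.\<close>
    have 1: "len v < len (v \<otimes> r)"
    proof (rule ccontr)
      assume "\<not> ?thesis"
      then have l: "len v = Suc (len (v \<otimes> r))" using len_mult_gen[of v r] v r by auto
      have "w = v \<otimes> r \<otimes> ?A j" unfolding Ar[symmetric] using v r s t
        by (simp add: m_assoc gen_cancel_left)
      moreover have "len (?A j) \<le> j" using len_alternating s t(1) .
      ultimately have "len w \<le> len (v \<otimes> r) + j" using len_mult_le[of "v \<otimes> r" "?A j"] v r s t by auto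
      then show False using l v j by auto
    qed
    \<comment> \<open>Otherwise the alternating suffix could be extended by \<open>r'\<close> on the left.\<close>
    have 2: "len v < len (v \<otimes> r')"
    proof (rule ccontr)
      assume "\<not> ?thesis"
      then have l: "len v = Suc (len (v \<otimes> r'))" using len_mult_gen[of v r'] v r by auto
      have "w = v \<otimes> r' \<otimes> ?A (Suc k)" unfolding Ar'[symmetric] using v r s t
        by (simp add: m_assoc gen_cancel_left)
      then have "?P (Suc k)" using l v r by (intro bexI[of _ "v \<otimes> r'"]) auto
      then show False using max by force
    qed
    have "len v < len w" using v \<open>k \<ge> 1\<close> by auto
    then have "\<rho> v (\<alpha> r) \<in> simple_cone" "\<rho> v (\<alpha> r') \<in> simple_cone"
      using less.hyps[of v] v r 1 2 by auto
    then have vst: "\<rho> v (\<alpha> s) \<in> simple_cone" "\<rho> v (\<alpha> t) \<in> simple_cone" using r(3) by (auto simp: doubleton_eq_iff)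
    have nn: "chebyshev (- B (\<alpha> s) (\<alpha> t)) (Suc k) \<ge> 0 \<and> chebyshev (- B (\<alpha> s) (\<alpha> t)) k \<ge> 0"
    proof (cases rule: simple_form_cases[OF s t(1) \<open>s \<noteq> t\<close>])
      case 1
      then show ?thesis using chebyshev_ge_1 by blast
    next
      case (2 m)
      have "k < m"
      proof (rule ccontr)
        assume "\<not> k < m"
        then have "len (?A k \<otimes> s) < k" using alternating_shortens[OF s t(1) 2] by auto
        moreover have "len (w \<otimes> s) \<le> len v + len (?A k \<otimes> s)"
          using len_mult_le[of v "?A k \<otimes> s"] v s t by (simp add: m_assoc)
        ultimately show False using less.prems v by auto
      qed
      then show ?thesis unfolding 2(2) using chebyshev_cos_nonneg[OF 2(1)] by simp
    qed
    obtain p q where pq: "p \<ge> 0" "q \<ge> 0" "\<rho> (?A k) (\<alpha> s) = p *\<^sub>R \<alpha> s + q *\<^sub>R \<alpha> t"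
      using alternating_nonneg[OF s t(1)] nn by blast
    have "\<rho> w (\<alpha> s) = p *\<^sub>R \<rho> v (\<alpha> s) + q *\<^sub>R \<rho> v (\<alpha> t)"
      using v s t pq by (simp add: rho_simps)
    then show ?thesis using vst pq by (auto intro: nonneg_cone_add nonneg_cone_scale)
  qed
qed


lemma roots_iff: "\<beta> \<in> roots \<longleftrightarrow> (\<exists>w\<in>carrier W. \<exists>s\<in>S. \<beta> = \<rho> w (\<alpha> s))"
  unfolding roots_def by auto

lemma simple_root [simp]: "s \<in> S \<Longrightarrow> \<alpha> s \<in> roots"
  unfolding roots_iff by (metis one_closed rho_one)

lemma rho_root [simp]: "w \<in> carrier W \<Longrightarrow> \<beta> \<in> roots \<Longrightarrow> \<rho> w \<beta> \<in> roots"
  unfolding roots_iff by (metis m_closed rho_mult)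

lemma uminus_root [simp]: "- \<beta> \<in> roots \<longleftrightarrow> \<beta> \<in> roots"
proof -
  have "- \<beta> \<in> roots" if b: "\<beta> \<in> roots" for \<beta>
  proof -
    obtain w s where w: "w \<in> carrier W" "s \<in> S" "\<beta> = \<rho> w (\<alpha> s)" using b unfolding roots_def by auto
    then have "- \<beta> = \<rho> (w \<otimes> s) (\<alpha> s)" by (simp add: rho_simps)
    then show ?thesis using w by (metis rho_root simple_root m_closed gen_closed)
  qed
  from this[of \<beta>] this[of "- \<beta>"] show ?thesis by auto
qed

lemma root_unit: "\<beta> \<in> roots \<Longrightarrow> B \<beta> \<beta> = 1"
  unfolding roots_def by auto

lemma zero_not_root [simp]: "0 \<notin> roots"
  using root_unit[of 0] by (auto simp: form_simps)

lemma pos_roots_iff: "\<beta> \<in> pos_roots \<longleftrightarrow> \<beta> \<in> roots \<and> \<beta> \<in> simple_cone"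
  unfolding pos_roots_def by auto

lemma pos_root [simp]: "\<beta> \<in> pos_roots \<Longrightarrow> \<beta> \<in> roots"
  and pos_root_cone: "\<beta> \<in> pos_roots \<Longrightarrow> \<beta> \<in> simple_cone"
  by (auto simp: pos_roots_iff)

lemma simple_pos_root [simp]: "s \<in> S \<Longrightarrow> \<alpha> s \<in> pos_roots"
  by (simp add: pos_roots_iff)

text \<open>
For \<open>\<beta> = w \<alpha>\<^sub>s\<close>, either \<open>w s\<close> is longer than \<open>w\<close>, and \<open>\<beta>\<close> is positive, or \<open>w\<close> is longer than
\<open>w s\<close>, and \<open>-\<beta> = w s \<alpha>\<^sub>s\<close> is.  Both signs at once are excluded because the cone is pointed.
\<close>
lemma uminus_pos_root:
  assumes "\<beta> \<in> roots"
  shows "- \<beta> \<in> pos_roots \<longleftrightarrow> \<beta> \<notin> pos_roots"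
proof
  assume "- \<beta> \<in> pos_roots"
  then show "\<beta> \<notin> pos_roots"
    using simple_cone_pointed[of \<beta>] assms by (auto simp: pos_roots_iff)
next
  assume "\<beta> \<notin> pos_roots"
  obtain w s where w: "w \<in> carrier W" "s \<in> S" "\<beta> = \<rho> w (\<alpha> s)" using assms unfolding roots_def by auto
  show "- \<beta> \<in> pos_roots"
  proof (cases "len w < len (w \<otimes> s)")
    case True
    then show ?thesis
      using length_increase_positive[of w s] w assms \<open>\<beta> \<notin> pos_roots\<close> by (auto simp: pos_roots_iff)
  next
    case False
    then have "len (w \<otimes> s) < len (w \<otimes> s \<otimes> s)"
      using len_mult_gen[of w s] w by (auto simp: gen_cancel_right)
    then show ?thesis
      using length_increase_positive[of "w \<otimes> s" s] w assms by (auto simp: pos_roots_iff rho_simps)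
  qed
qed

lemma neg_roots_iff: "\<beta> \<in> neg_roots \<longleftrightarrow> - \<beta> \<in> pos_roots"
  unfolding neg_roots_def by (metis image_iff minus_minus)

lemma len_mult_gen_iff:
  assumes "w \<in> carrier W" "s \<in> S"
  shows "len w < len (w \<otimes> s) \<longleftrightarrow> \<rho> w (\<alpha> s) \<in> pos_roots"
proof
  assume "len w < len (w \<otimes> s)"
  then show "\<rho> w (\<alpha> s) \<in> pos_roots" 
    using length_increase_positive assms by (auto simp: pos_roots_iff)
next
  assume p: "\<rho> w (\<alpha> s) \<in> pos_roots"
  show "len w < len (w \<otimes> s)"
  proof (rule ccontr)
    assume "\<not> ?thesis"
    then have "len (w \<otimes> s) < len (w \<otimes> s \<otimes> s)"
      using len_mult_gen[of w s] assms by (auto simp: gen_cancel_right)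
    then have "- \<rho> w (\<alpha> s) \<in> pos_roots"
      using length_increase_positive[of "w \<otimes> s" s] assms by (auto simp: pos_roots_iff rho_simps)
    then show False using p uminus_pos_root by auto
  qed
qed

text \<open>
If \<open>s\<close> made \<open>\<beta>\<close> negative, then \<open>\<beta>\<close> and \<open>-s(\<beta>)\<close> would be two points of the cone with sum on the
ray of \<open>\<alpha>\<^sub>s\<close>; this ray is extremal, and \<open>\<alpha>\<^sub>s\<close> is the only root on it.
\<close>
lemma simple_reflection_pos_root:
  assumes "s \<in> S" "\<beta> \<in> pos_roots" "\<beta> \<noteq> \<alpha> s"
  shows "\<rho> s \<beta> \<in> pos_roots"
proof (rule ccontr)
  assume "\<rho> s \<beta> \<notin> pos_roots"
  then have "- \<rho> s \<beta> \<in> simple_cone"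
    using uminus_pos_root[of "\<rho> s \<beta>"] assms pos_root_cone[of "- \<rho> s \<beta>"] by simp
  moreover have "\<beta> + - \<rho> s \<beta> = (2 * B (\<alpha> s) \<beta>) *\<^sub>R \<alpha> s" using assms by (simp add: reflection)
  ultimately obtain c where c: "c \<ge> 0" "\<beta> = c *\<^sub>R \<alpha> s"
    using simple_root_extremal[OF assms(1) pos_root_cone[OF assms(2)]] by metis
  have "B (c *\<^sub>R \<alpha> s) (c *\<^sub>R \<alpha> s) = 1" using root_unit[of \<beta>] assms(2) c(2) by simp
  then have "c * c = 1" using assms(1) by (simp add: form_simps)
  then have "c = 1 \<or> c = - 1" by (simp add: square_eq_1_iff)
  then have "c = 1" using c(1) by auto
  then show False using c assms by simp
qed

section \<open>Inversion sets and the weak order\<close>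

lemma inversions_iff:
  assumes "w \<in> carrier W"
  shows "\<beta> \<in> inversions w \<longleftrightarrow> \<beta> \<in> pos_roots \<and> \<rho> (inv w) \<beta> \<notin> pos_roots"
proof -
  have "\<beta> \<in> \<rho> w ` neg_roots \<longleftrightarrow> \<rho> (inv w) \<beta> \<in> neg_roots"
    using assms by (metis image_iff rho_inv)
  then show ?thesis unfolding inversions_def using assms
    by (auto simp: neg_roots_iff uminus_pos_root)
qed

lemma inversions_pos: "\<beta> \<in> inversions w \<Longrightarrow> \<beta> \<in> pos_roots"
  unfolding inversions_def by auto

lemma inversions_one [simp]: "inversions \<one> = {}"
  by (auto simp: inversions_iff)

lemma simple_inversion_iff:
  assumes "w \<in> carrier W" "s \<in> S"
  shows "\<alpha> s \<in> inversions w \<longleftrightarrow> len w = Suc (len (s \<otimes> w))"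
proof -
  have "\<alpha> s \<in> inversions w \<longleftrightarrow> \<not> len (inv w) < len (inv w \<otimes> s)"
    using len_mult_gen_iff[of "inv w" s] assms by (simp add: inversions_iff)
  also have "\<dots> \<longleftrightarrow> len w = Suc (len (s \<otimes> w))"
    unfolding len_gen_mult[OF assms] using len_mult_gen[of "inv w" s] len_inv[OF assms(1)] assms by force
  finally show ?thesis .
qed

lemma inversions_gen_mult:
  assumes "w \<in> carrier W" "s \<in> S" "\<alpha> s \<notin> inversions w"
  shows "inversions (s \<otimes> w) = insert (\<alpha> s) (\<rho> s ` inversions w)"
proof (rule Set.set_eqI)
  fix \<beta>
  have inv: "\<rho> (inv (s \<otimes> w)) x = \<rho> (inv w) (\<rho> s x)" for x using assms by (simp add: inv_mult_group)
  have img: "\<beta> \<in> \<rho> s ` inversions w \<longleftrightarrow> \<rho> s \<beta> \<in> inversions w"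
    using assms by (metis image_iff rho_gen_gen)
  show "\<beta> \<in> inversions (s \<otimes> w) \<longleftrightarrow> \<beta> \<in> insert (\<alpha> s) (\<rho> s ` inversions w)"
  proof (cases "\<beta> = \<alpha> s")
    case True
    have "\<rho> (inv w) (\<alpha> s) \<in> pos_roots" using assms by (auto simp: inversions_iff)
    then show ?thesis using True assms inv
      by (auto simp: inversions_iff rho_simps uminus_pos_root)
  next
    case False
    have "\<rho> s \<beta> \<in> pos_roots \<longleftrightarrow> \<beta> \<in> pos_roots" if "\<rho> s \<beta> \<noteq> \<alpha> s"
      using simple_reflection_pos_root[of s \<beta>] simple_reflection_pos_root[of s "\<rho> s \<beta>"] that False assms by auto
    moreover have "\<beta> \<notin> pos_roots \<and> \<rho> s \<beta> \<notin> inversions w" if "\<rho> s \<beta> = \<alpha> s"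
    proof -
      have "\<beta> = - \<alpha> s" using that assms by (metis rho_gen_gen rho_simple)
      then show ?thesis using that assms(2,3) by (simp add: uminus_pos_root)
    qed
    moreover have "\<beta> \<in> inversions (s \<otimes> w) \<longleftrightarrow> \<beta> \<in> pos_roots \<and> \<rho> (inv w) (\<rho> s \<beta>) \<notin> pos_roots"
      using assms inv inversions_iff[of "s \<otimes> w"] by simp
    moreover have "\<rho> s \<beta> \<in> inversions w \<longleftrightarrow> \<rho> s \<beta> \<in> pos_roots \<and> \<rho> (inv w) (\<rho> s \<beta>) \<notin> pos_roots"
      using assms inversions_iff by simp
    ultimately show ?thesis using False img by blast
  qed
qed

lemma inversions_gen [simp]: "s \<in> S \<Longrightarrow> inversions s = {\<alpha> s}"
  using inversions_gen_mult[of \<one> s] by simp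

text \<open>
Cancelling the first letter \<open>s\<close> of \<open>w\<close>, for an induction on the length from the left.
\<close>
lemma inversions_strip:
  assumes "w \<in> carrier W" "s \<in> S" "\<alpha> s \<in> inversions w"
  shows "inversions w = insert (\<alpha> s) (\<rho> s ` inversions (s \<otimes> w))"
    and "\<alpha> s \<notin> inversions (s \<otimes> w)" and "len w = Suc (len (s \<otimes> w))"
proof -
  show 1: "len w = Suc (len (s \<otimes> w))" using assms simple_inversion_iff by auto
  then show 2: "\<alpha> s \<notin> inversions (s \<otimes> w)" using assms simple_inversion_iff[of "s \<otimes> w" s]
    by (auto simp: gen_cancel_left)
  show "inversions w = insert (\<alpha> s) (\<rho> s ` inversions (s \<otimes> w))"
    using inversions_gen_mult[OF _ assms(2) 2] assms by (simp add: gen_cancel_left)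
qed

lemma first_inversion:
  assumes "w \<in> carrier W" "w \<noteq> \<one>"
  obtains s where "s \<in> S" "\<alpha> s \<in> inversions w"
  using first_letter[OF assms] simple_inversion_iff assms by metis

lemma finite_inversions [simp]: "w \<in> carrier W \<Longrightarrow> finite (inversions w)"
proof (induct "len w" arbitrary: w rule: less_induct)
  case less
  show ?case
  proof (cases "w = \<one>")
    case False
    then obtain s where s: "s \<in> S" "\<alpha> s \<in> inversions w" using first_inversion less by blast
    then show ?thesis using inversions_strip[OF less(2) s] less(1)[of "s \<otimes> w"] less(2) by auto
  qed simp
qed

lemma inversions_strip_mono:
  assumes "u \<in> carrier W" "w \<in> carrier W" "s \<in> S" "\<alpha> s \<in> inversions u" "\<alpha> s \<in> inversions w"
  shows "inversions (s \<otimes> u) \<subseteq> inversions (s \<otimes> w) \<longleftrightarrow> inversions u \<subseteq> inversions w"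
proof -
  note u = inversions_strip[OF assms(1,3,4)] and w = inversions_strip[OF assms(2,3,5)]
  have "\<alpha> s \<notin> \<rho> s ` inversions (s \<otimes> v)" for v
  proof
    assume "\<alpha> s \<in> \<rho> s ` inversions (s \<otimes> v)"
    then have "\<rho> s (\<alpha> s) \<in> inversions (s \<otimes> v)" using assms by (metis image_iff rho_gen_gen)
    then have "- \<alpha> s \<in> pos_roots" using assms(3) inversions_pos by fastforce
    then show False using assms(3) by (simp add: uminus_pos_root)
  qed
  moreover have "\<rho> s ` X \<subseteq> \<rho> s ` Y \<longleftrightarrow> X \<subseteq> Y" for X Y
    using assms by (intro inj_image_subset_iff injI) simp
  ultimately show ?thesis unfolding u(1) w(1) by (simp add: subset_insert)
qed

text \<open>
The inverse of \<open>w\<close> maps \<open>A\<close> into the negative cone, hence also the cone over \<open>A\<close>.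
\<close>
lemma inversions_convex:
  assumes "w \<in> carrier W" "A \<subseteq> inversions w"
  shows "root_cone A \<subseteq> inversions w"
proof
  fix \<beta> assume b: "\<beta> \<in> root_cone A"
  then have r: "\<beta> \<in> roots" "\<beta> \<in> nonneg_cone A" unfolding root_cone_def by auto
  have "A \<subseteq> simple_cone" using assms(2) inversions_pos pos_root_cone by blast
  then have p: "\<beta> \<in> pos_roots" using r nonneg_cone_subset_cone by (auto simp: pos_roots_iff)
  have "linear (\<lambda>x. - \<rho> (inv w) x)" using rho_linear[of "inv w"] assms(1) by (simp add: linear_compose_neg)
  moreover have "- \<rho> (inv w) a \<in> simple_cone" if "a \<in> A" for a
  proof -
    have "a \<in> pos_roots" "\<rho> (inv w) a \<notin> pos_roots" using that assms by (auto simp: inversions_iff)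
    then show ?thesis using assms(1) uminus_pos_root[of "\<rho> (inv w) a"] by (simp add: pos_root_cone)
  qed
  then have "(\<lambda>x. - \<rho> (inv w) x) ` A \<subseteq> simple_cone" by auto
  ultimately have "- \<rho> (inv w) \<beta> \<in> simple_cone"
    using nonneg_cone_linear_image[of "\<lambda>x. - \<rho> (inv w) x" \<beta> A "\<alpha> ` S"] r(2) by simp
  then have "- \<rho> (inv w) \<beta> \<in> pos_roots" using r assms by (auto simp: pos_roots_iff)
  then show "\<beta> \<in> inversions w" using p r assms by (auto simp: inversions_iff uminus_pos_root)
qed

lemma root_cone_base: "A \<subseteq> roots \<Longrightarrow> A \<subseteq> root_cone A"
  unfolding root_cone_def by (auto intro: nonneg_cone_base)

lemma root_cone_mono: "A \<subseteq> C \<Longrightarrow> root_cone A \<subseteq> root_cone C"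
  unfolding root_cone_def using nonneg_cone_mono by blast

lemma root_cone_subset_cone: "A \<subseteq> nonneg_cone C \<Longrightarrow> root_cone A \<subseteq> root_cone C"
  unfolding root_cone_def using nonneg_cone_subset_cone by blast

lemma inversions_root: "inversions w \<subseteq> roots"
  using inversions_pos by auto

text \<open>
Cancel a common first letter on both sides.  If the first letter of \<open>u\<close> is not an inversion of \<open>w\<close>,
then neither side holds.
\<close>
theorem weak_order_iff_inversions:
  assumes "u \<in> carrier W" "w \<in> carrier W"
  shows "u \<sqsubseteq>\<^bsub>weak_order\<^esub> w \<longleftrightarrow> inversions u \<subseteq> inversions w"
  using assms
proof (induct "len u" arbitrary: u w rule: less_induct)
  case less
  note uw = less.prems
  show ?case
  proof (cases "u = \<one>")
    case False
    then obtain s where s: "s \<in> S" "\<alpha> s \<in> inversions u" using first_inversion uw by blast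
    note u = inversions_strip[OF uw(1) s]
    have cancel: "u \<otimes> (inv u \<otimes> w) = w" using uw by (simp add: m_assoc[symmetric])
    have eq: "inv (s \<otimes> u) \<otimes> (s \<otimes> w) = inv u \<otimes> w" using s uw by (simp add: inv_mult_group m_assoc gen_cancel_left)
    have IH: "len (s \<otimes> w) = len (s \<otimes> u) + len (inv u \<otimes> w) \<longleftrightarrow> inversions (s \<otimes> u) \<subseteq> inversions (s \<otimes> w)"
      using less.hyps[of "s \<otimes> u" "s \<otimes> w"] u uw s eq by simp
    show ?thesis
    proof (cases "\<alpha> s \<in> inversions w")
      case True
      then show ?thesis
        using IH inversions_strip[OF uw(2) s(1) True] u inversions_strip_mono[OF uw s True] by simp
    next
      case False
      have "s \<otimes> w = s \<otimes> u \<otimes> (inv u \<otimes> w)" using uw s cancel by (simp add: m_assoc)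
      then have "len (s \<otimes> w) \<le> len (s \<otimes> u) + len (inv u \<otimes> w)"
        using len_mult_le[of "s \<otimes> u" "inv u \<otimes> w"] uw s by simp
      moreover have "len w < len (s \<otimes> w)" 
        using False uw s simple_inversion_iff[OF uw(2) s(1)] len_mult_gen[of "inv w" s] by (auto simp: len_gen_mult)
      ultimately show ?thesis using False s u by auto
    qed
  qed (use uw in simp)
qed

lemma inversions_inj:
  assumes "u \<in> carrier W" "w \<in> carrier W" "inversions u = inversions w"
  shows "u = w"
proof -
  have "len w = len u + len (inv u \<otimes> w)" "len u = len w + len (inv w \<otimes> u)"
    using weak_order_iff_inversions[of u w] weak_order_iff_inversions[of w u] assms by auto
  then have "inv u \<otimes> w = \<one>" using assms by (subst len_eq_0[symmetric]) auto
  then show ?thesis using assms by (metis inv_equality inv_inv inv_closed)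
qed


section \<open>Joins in the weak order\<close>

lemma simple_reflection_pos_iff:
  assumes "s \<in> S" "\<beta> \<noteq> \<alpha> s" "\<beta> \<noteq> - \<alpha> s"
  shows "\<rho> s \<beta> \<in> pos_roots \<longleftrightarrow> \<beta> \<in> pos_roots"
proof -
  have "\<rho> s \<beta> \<noteq> \<alpha> s" using assms by (metis rho_gen_gen rho_simple)
  then show ?thesis
    using simple_reflection_pos_root[of s \<beta>] simple_reflection_pos_root[of s "\<rho> s \<beta>"] assms by auto
qed

lemma inversions_mult_gen:
  assumes "w \<in> carrier W" "s \<in> S" "\<rho> w (\<alpha> s) \<in> pos_roots"
  shows "inversions (w \<otimes> s) = insert (\<rho> w (\<alpha> s)) (inversions w)"
proof (rule Set.set_eqI)
  fix \<beta>
  have iff: "\<beta> \<in> inversions (w \<otimes> s) \<longleftrightarrow> \<beta> \<in> pos_roots \<and> \<rho> s (\<rho> (inv w) \<beta>) \<notin> pos_roots"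
    using assms inversions_iff[of "w \<otimes> s"] by (simp add: inv_mult_group)
  show "\<beta> \<in> inversions (w \<otimes> s) \<longleftrightarrow> \<beta> \<in> insert (\<rho> w (\<alpha> s)) (inversions w)"
  proof (cases "\<rho> (inv w) \<beta> = \<alpha> s \<or> \<rho> (inv w) \<beta> = - \<alpha> s")
    case True
    then have "\<beta> = \<rho> w (\<alpha> s) \<or> \<beta> = - \<rho> w (\<alpha> s)" using assms by (metis rho_inv(2) rho_simps(4))
    then show ?thesis
    proof
      assume "\<beta> = \<rho> w (\<alpha> s)"
      then show ?thesis using assms iff by (simp add: uminus_pos_root)
    next
      assume b: "\<beta> = - \<rho> w (\<alpha> s)"
      then have "\<beta> \<notin> pos_roots" using assms by (simp add: uminus_pos_root)
      then show ?thesis using assms iff inversions_pos by auto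
    qed
  next
    case False
    then have "\<rho> s (\<rho> (inv w) \<beta>) \<in> pos_roots \<longleftrightarrow> \<rho> (inv w) \<beta> \<in> pos_roots"
      using simple_reflection_pos_iff assms by blast
    moreover have "\<beta> \<noteq> \<rho> w (\<alpha> s)" using False assms by auto
    ultimately show ?thesis using iff inversions_iff assms by auto
  qed
qed

text \<open>
A point of the simple cone in the plane of two simple roots lies between these two, although it
may also involve other simple roots: with \<open>p < 0\<close>, the ray of \<open>\<alpha>\<^sub>t\<close> would contain a sum of
two points of the cone one of which is on the ray of \<open>\<alpha>\<^sub>s\<close>.
\<close>
lemma simple_cone_coeff_nonneg:
  assumes "s \<in> S" "t \<in> S" "s \<noteq> t" "p *\<^sub>R \<alpha> s + q *\<^sub>R \<alpha> t \<in> simple_cone"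
  shows "p \<ge> 0"
proof (rule ccontr)
  assume p: "\<not> p \<ge> 0"
  have "(- p) *\<^sub>R \<alpha> s + (p *\<^sub>R \<alpha> s + q *\<^sub>R \<alpha> t) = q *\<^sub>R \<alpha> t" by simp
  moreover have "(- p) *\<^sub>R \<alpha> s \<in> simple_cone" using p assms(1) by (intro nonneg_cone_scale) auto
  ultimately obtain c where c: "c \<ge> 0" "(- p) *\<^sub>R \<alpha> s = c *\<^sub>R \<alpha> t"
    using simple_root_extremal[OF assms(2) _ assms(4)] by metis
  have "B (\<alpha> s) ((- p) *\<^sub>R \<alpha> s) = c * B (\<alpha> s) (\<alpha> t)" unfolding c(2) by (simp add: form_simps)
  then have "- p = c * B (\<alpha> s) (\<alpha> t)" using assms(1) by (simp add: form_simps)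
  moreover have "c * B (\<alpha> s) (\<alpha> t) \<le> 0" using c(1) simple_form_nonpos[OF assms(1-3)]
    by (rule mult_nonneg_nonpos)
  ultimately show False using p by simp
qed

text \<open>
The element sought is the longest element of the dihedral group generated by \<open>s\<close> and \<open>t\<close>.  That this
group is finite is encoded in the hypothesis: all positive roots of the plane are inversions of
\<open>g\<close>.  So there is an element \<open>u\<close> with as many inversions as possible among those that
preserve the plane and have all their inversions in it.  By maximality \<open>u\<close> makes \<open>\<alpha>\<^sub>s\<close> and \<open>\<alpha>\<^sub>t\<close>
negative.  Then it reverses the cone they span, so both are inversions of \<open>u\<close>, and convexity gives
the rest.
\<close>
lemma dihedral_longest_element:
  assumes "s \<in> S" "t \<in> S" "s \<noteq> t" "g \<in> carrier W" "\<alpha> s \<in> inversions g" "\<alpha> t \<in> inversions g"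
  shows "\<exists>u\<in>carrier W. inversions u = root_cone {\<alpha> s, \<alpha> t}"
proof -
  let ?C = "root_cone {\<alpha> s, \<alpha> t}"
  define P where "P = {p *\<^sub>R \<alpha> s + q *\<^sub>R \<alpha> t | p q. True}"
  \<comment> \<open>Stability of the plane under \<open>u\<close> and its inverse stands for membership in the group generated by \<open>s\<close> and \<open>t\<close>.\<close>
  define D where "D u \<longleftrightarrow> u \<in> carrier W \<and> inversions u \<subseteq> ?C \<and> (\<forall>x\<in>P. \<rho> u x \<in> P \<and> \<rho> (inv u) x \<in> P)" for u
  have finC: "finite ?C" 
    using inversions_convex[OF assms(4), of "{\<alpha> s, \<alpha> t}"] assms(5,6) finite_inversions[OF assms(4)]
    by (intro finite_subset[of ?C "inversions g"]) auto
  have simpleP: "\<alpha> s \<in> P" "\<alpha> t \<in> P" unfolding P_def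
    by (rule CollectI, rule exI[of _ 1], rule exI[of _ 0], simp) (rule CollectI, rule exI[of _ 0], rule exI[of _ 1], simp)
  have P_pos: "\<exists>p\<ge>0. \<exists>q\<ge>0. x = p *\<^sub>R \<alpha> s + q *\<^sub>R \<alpha> t" if "x \<in> P" "x \<in> simple_cone" for x
  proof -
    obtain p q where x: "x = p *\<^sub>R \<alpha> s + q *\<^sub>R \<alpha> t" using \<open>x \<in> P\<close> unfolding P_def by auto
    have "p \<ge> 0" using simple_cone_coeff_nonneg[OF assms(1-3)] x that(2) by blast
    moreover have "q \<ge> 0" using simple_cone_coeff_nonneg[OF assms(2,1), of q p] assms(3) x that(2)
      by (auto simp: add.commute)
    ultimately show ?thesis using x by auto
  qed
  have P_root: "x \<in> ?C" if x: "x \<in> P" "x \<in> pos_roots" for x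
  proof -
    obtain p q where "p \<ge> 0" "q \<ge> 0" "x = p *\<^sub>R \<alpha> s + q *\<^sub>R \<alpha> t" using P_pos x pos_root_cone by blast
    then have "x \<in> nonneg_cone {\<alpha> s, \<alpha> t}"
      by (auto intro!: nonneg_cone_add nonneg_cone_scale intro: nonneg_cone_base)
    then show ?thesis using x unfolding root_cone_def by auto
  qed
  have reflP: "\<rho> r x \<in> P" if r: "r \<in> {s, t}" and x: "x \<in> P" for r x
  proof -
    obtain p q where x: "x = p *\<^sub>R \<alpha> s + q *\<^sub>R \<alpha> t" using x unfolding P_def by auto
    have rS: "r \<in> S" using r assms by auto
    define b where "b = 2 * B (\<alpha> r) x"
    have "\<rho> r x = x - b *\<^sub>R \<alpha> r" using rS by (simp add: reflection b_def)
    then have "\<rho> r x = (p - b) *\<^sub>R \<alpha> s + q *\<^sub>R \<alpha> t \<or> \<rho> r x = p *\<^sub>R \<alpha> s + (q - b) *\<^sub>R \<alpha> t"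
      using r x by (auto simp: algebra_simps)
    then show ?thesis unfolding P_def by auto
  qed
  have D1: "D \<one>" unfolding D_def by simp
  obtain u where u: "D u" "\<And>v. D v \<Longrightarrow> card (inversions v) \<le> card (inversions u)"
  proof -
    have "\<exists>u. D u \<and> (\<forall>v. D v \<longrightarrow> card (inversions v) \<le> card (inversions u))"
    proof (rule ex_has_greatest_nat[of D \<one> "\<lambda>u. card (inversions u)" "Suc (card ?C)"])
      show "\<forall>v. D v \<longrightarrow> card (inversions v) < Suc (card ?C)"
        using finC by (auto simp: D_def less_Suc_eq_le intro: card_mono)
    qed (rule D1)
    then show ?thesis using that by blast
  qed
  have uW: "u \<in> carrier W" using u D_def by auto
  have neg: "\<rho> u (\<alpha> r) \<notin> pos_roots" if r: "r \<in> {s, t}" for r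
  proof
    assume p: "\<rho> u (\<alpha> r) \<in> pos_roots"
    have rS: "r \<in> S" using r assms by auto
    have N: "inversions (u \<otimes> r) = insert (\<rho> u (\<alpha> r)) (inversions u)"
      using inversions_mult_gen[OF uW rS p] .
    have "\<rho> u (\<alpha> r) \<in> P" using u(1) r simpleP unfolding D_def by auto
    then have "inversions (u \<otimes> r) \<subseteq> ?C" using N P_root p u(1) unfolding D_def by auto
    moreover have "\<rho> (u \<otimes> r) x \<in> P \<and> \<rho> (inv (u \<otimes> r)) x \<in> P" if x: "x \<in> P" for x
    proof
      show "\<rho> (u \<otimes> r) x \<in> P" using reflP[OF r x] u(1) uW rS unfolding D_def by simp
      have "\<rho> (inv u) x \<in> P" using x u(1) unfolding D_def by auto
      then show "\<rho> (inv (u \<otimes> r)) x \<in> P" using reflP[OF r] uW rS by (simp add: inv_mult_group)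
    qed
    ultimately have "D (u \<otimes> r)" using uW rS unfolding D_def by simp
    moreover have "\<rho> u (\<alpha> r) \<notin> inversions u" using uW rS by (simp add: inversions_iff)
    ultimately show False using u(2)[of "u \<otimes> r"] N uW by simp
  qed
  have neg': "- \<rho> u (\<alpha> r) \<in> simple_cone" if "r \<in> {s, t}" for r
    using neg[OF that] uminus_pos_root[of "\<rho> u (\<alpha> r)"] that assms uW pos_root_cone by auto
  have mem: "\<alpha> r \<in> inversions u" if r: "r \<in> {s, t}" for r
  proof (rule ccontr)
    assume "\<alpha> r \<notin> inversions u"
    then have p: "\<rho> (inv u) (\<alpha> r) \<in> pos_roots" using r assms uW inversions_iff by auto
    have "\<rho> (inv u) (\<alpha> r) \<in> P" using u(1) r simpleP unfolding D_def by auto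
    then obtain a b where ab: "a \<ge> 0" "b \<ge> 0" "\<rho> (inv u) (\<alpha> r) = a *\<^sub>R \<alpha> s + b *\<^sub>R \<alpha> t"
      using P_pos p pos_root_cone by blast
    have "\<alpha> r = \<rho> u (\<rho> (inv u) (\<alpha> r))" using uW by simp
    also have "\<dots> = a *\<^sub>R \<rho> u (\<alpha> s) + b *\<^sub>R \<rho> u (\<alpha> t)" unfolding ab(3) using uW by (simp add: rho_simps)
    finally have "- \<alpha> r = a *\<^sub>R (- \<rho> u (\<alpha> s)) + b *\<^sub>R (- \<rho> u (\<alpha> t))" by simp
    also have "\<dots> \<in> simple_cone" using ab neg' by (intro nonneg_cone_add nonneg_cone_scale) auto
    finally have "- \<alpha> r \<in> simple_cone" .
    then have "\<alpha> r = 0" using simple_cone_pointed r assms by auto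
    then show False using r assms simple_root by (metis insertE singletonD zero_not_root)
  qed
  have "?C \<subseteq> inversions u" using inversions_convex[OF uW, of "{\<alpha> s, \<alpha> t}"] mem by auto
  then show ?thesis using u(1) uW unfolding D_def by blast
qed

text \<open>
Induction on the length of the bound \<open>g\<close>: a common first letter can be cancelled, and for
different first letters \<open>s\<close> and \<open>t\<close> the element with inversion set \<open>root_cone {\<alpha>\<^sub>s, \<alpha>\<^sub>t}\<close> is joined
to \<open>x\<close> and to \<open>y\<close> first, which is possible because it has a letter in common with each of them.
\<close>
lemma join_of_two_inversion_sets:
  assumes "g \<in> carrier W" "x \<in> carrier W" "y \<in> carrier W"
    "inversions x \<subseteq> inversions g" "inversions y \<subseteq> inversions g"
  shows "\<exists>w\<in>carrier W. inversions w = root_cone (inversions x \<union> inversions y)"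
  using assms
proof (induct "len g" arbitrary: g x y rule: less_induct)
  case less
  note g = less.prems(1)
  have common: "\<exists>w\<in>carrier W. inversions w = root_cone (inversions x \<union> inversions y)"
    if s: "s \<in> S" and x: "x \<in> carrier W" "\<alpha> s \<in> inversions x" "inversions x \<subseteq> inversions g"
      and y: "y \<in> carrier W" "\<alpha> s \<in> inversions y" "inversions y \<subseteq> inversions g" for x y s
  proof -
    have sg: "\<alpha> s \<in> inversions g" using x by auto
    note Ng = inversions_strip[OF g s sg]
    note Nx = inversions_strip[OF x(1) s x(2)]
    note Ny = inversions_strip[OF y(1) s y(2)]
    let ?A = "inversions (s \<otimes> x) \<union> inversions (s \<otimes> y)"
    have sub: "inversions (s \<otimes> x) \<subseteq> inversions (s \<otimes> g)" "inversions (s \<otimes> y) \<subseteq> inversions (s \<otimes> g)"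
      using inversions_strip_mono x y g s sg by auto
    obtain w where w: "w \<in> carrier W" "inversions w = root_cone ?A"
      using less.hyps[of "s \<otimes> g" "s \<otimes> x" "s \<otimes> y"] Ng(3) sub g x y s by auto
    have "inversions w \<subseteq> inversions (s \<otimes> g)" unfolding w(2) using inversions_convex sub g s by simp
    then have "\<alpha> s \<notin> inversions w" using Ng by auto
    then have N: "inversions (s \<otimes> w) = insert (\<alpha> s) (\<rho> s ` inversions w)"
      using inversions_gen_mult w s by auto
    have "?A \<subseteq> inversions w" unfolding w(2) by (rule root_cone_base) (use inversions_root in auto)
    then have "inversions x \<union> inversions y \<subseteq> inversions (s \<otimes> w)"
      unfolding N Nx(1) Ny(1) by auto
    then have 1: "root_cone (inversions x \<union> inversions y) \<subseteq> inversions (s \<otimes> w)"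
      using inversions_convex w s by simp
    have "\<rho> s \<gamma> \<in> root_cone (inversions x \<union> inversions y)" if "\<gamma> \<in> inversions w" for \<gamma>
    proof -
      have "\<rho> s ` ?A \<subseteq> nonneg_cone (inversions x \<union> inversions y)"
        unfolding Nx(1) Ny(1) by (auto intro: nonneg_cone_base)
      then have "\<rho> s \<gamma> \<in> nonneg_cone (inversions x \<union> inversions y)"
        using nonneg_cone_linear_image[OF rho_linear[of s], of \<gamma> ?A] that s
        unfolding w(2) root_cone_def by auto
      moreover have "\<gamma> \<in> roots" using that inversions_root by blast
      ultimately show ?thesis using s unfolding root_cone_def by auto
    qed
    moreover have "\<alpha> s \<in> root_cone (inversions x \<union> inversions y)"
      using x(2) s unfolding root_cone_def by (auto intro: nonneg_cone_base)
    ultimately have "inversions (s \<otimes> w) = root_cone (inversions x \<union> inversions y)"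
      using 1 unfolding N by auto
    then show ?thesis using w s by (intro bexI[of _ "s \<otimes> w"]) auto
  qed
  have closed: "root_cone (inversions z) = inversions z" if "z \<in> carrier W" for z
    using inversions_convex[OF that] root_cone_base[OF inversions_root] by auto
  show ?case
  proof (cases "x = \<one> \<or> y = \<one>")
    case True
    then show ?thesis using closed less.prems by auto
  next
    case False
    obtain s where s: "s \<in> S" "\<alpha> s \<in> inversions x" using first_inversion[of x] False less.prems by auto
    obtain t where t: "t \<in> S" "\<alpha> t \<in> inversions y" using first_inversion[of y] False less.prems by auto
    show ?thesis
    proof (cases "s = t")
      case True
      then show ?thesis using common s t less.prems by blast
    next
      case False
      obtain u where u: "u \<in> carrier W" "inversions u = root_cone {\<alpha> s, \<alpha> t}"
        using dihedral_longest_element[OF s(1) t(1) False g] s t less.prems by blast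
      have st: "\<alpha> s \<in> inversions u" "\<alpha> t \<in> inversions u"
        unfolding u(2) root_cone_def using s t by (auto intro: nonneg_cone_base)
      have ug: "inversions u \<subseteq> inversions g" unfolding u(2)
        using inversions_convex[OF g, of "{\<alpha> s, \<alpha> t}"] s t less.prems by auto
      obtain x' where x': "x' \<in> carrier W" "inversions x' = root_cone (inversions x \<union> inversions u)"
        using common[OF s(1) _ s(2) _ u(1) st(1) ug] less.prems by auto
      obtain y' where y': "y' \<in> carrier W" "inversions y' = root_cone (inversions y \<union> inversions u)"
        using common[OF t(1) _ t(2) _ u(1) st(2) ug] less.prems by auto
      have xs: "inversions x \<union> inversions u \<subseteq> inversions x'" unfolding x'(2)
        by (rule root_cone_base) (use inversions_root in auto)
      have ys: "inversions y \<union> inversions u \<subseteq> inversions y'" unfolding y'(2)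
        by (rule root_cone_base) (use inversions_root in auto)
      have le: "inversions x' \<subseteq> inversions g" "inversions y' \<subseteq> inversions g"
        unfolding x'(2) y'(2) using inversions_convex[OF g] ug less.prems by auto
      obtain w where w: "w \<in> carrier W" "inversions w = root_cone (inversions x' \<union> inversions y')"
        using common[OF s(1) x'(1) _ le(1) y'(1) _ le(2)] xs ys st(1) by blast
      let ?A = "inversions x \<union> inversions y"
      have "inversions u \<subseteq> nonneg_cone {\<alpha> s, \<alpha> t}" unfolding u(2) root_cone_def by auto
      also have "\<dots> \<subseteq> nonneg_cone ?A" using s t by (intro nonneg_cone_mono) auto
      finally have "inversions x \<union> inversions u \<subseteq> nonneg_cone ?A" "inversions y \<union> inversions u \<subseteq> nonneg_cone ?A"
        by (auto intro: nonneg_cone_base)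
      then have "inversions x' \<union> inversions y' \<subseteq> nonneg_cone ?A"
        unfolding x'(2) y'(2) root_cone_def using nonneg_cone_subset_cone by blast
      then have "root_cone (inversions x' \<union> inversions y') \<subseteq> root_cone ?A" by (rule root_cone_subset_cone)
      moreover have "root_cone ?A \<subseteq> root_cone (inversions x' \<union> inversions y')"
        by (rule root_cone_mono) (use xs ys in auto)
      ultimately show ?thesis using w by auto
    qed
  qed
qed

lemma root_cone_empty [simp]: "root_cone {} = {}"
  unfolding root_cone_def nonneg_cone_def by auto

text \<open>
A bounded set is finite, since its members are determined by subsets of \<open>N(g)\<close>; so binary joins
suffice.
\<close>
theorem inversion_set_of_bounded_union:
  assumes "g \<in> carrier W" "X \<subseteq> carrier W" "\<forall>x\<in>X. inversions x \<subseteq> inversions g"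
  shows "\<exists>w\<in>carrier W. inversions w = root_cone (\<Union>x\<in>X. inversions x)"
proof -
  have "inj_on inversions X" using inversions_inj assms(2) by (auto intro!: inj_onI)
  moreover have "inversions ` X \<subseteq> Pow (inversions g)" using assms by auto
  ultimately have "finite X"
    using finite_imageD[of inversions X] finite_subset[of "inversions ` X" "Pow (inversions g)"] assms(1) by simp
  then show ?thesis using assms(2,3)
  proof (induct X rule: finite_induct)
    case empty
    show ?case by (intro bexI[of _ \<one>]) auto
  next
    case (insert x X)
    let ?A = "\<Union>x\<in>X. inversions x"
    have X: "X \<subseteq> carrier W" "\<forall>x\<in>X. inversions x \<subseteq> inversions g" using insert(4,5) by auto
    obtain v where v: "v \<in> carrier W" "inversions v = root_cone ?A" using insert(3)[OF X] by blast
    have vg: "inversions v \<subseteq> inversions g" unfolding v(2)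
      by (rule inversions_convex[OF assms(1)]) (use X in auto)
    have x: "x \<in> carrier W" "inversions x \<subseteq> inversions g" using insert(4,5) by auto
    obtain w where w: "w \<in> carrier W" "inversions w = root_cone (inversions x \<union> inversions v)"
      using join_of_two_inversion_sets[OF assms(1) x(1) v(1) x(2) vg] by blast
    have "?A \<subseteq> inversions v" unfolding v(2) by (rule root_cone_base) (use inversions_root in auto)
    then have "root_cone (inversions x \<union> ?A) \<subseteq> root_cone (inversions x \<union> inversions v)"
      by (intro root_cone_mono) auto
    moreover have "nonneg_cone ?A \<subseteq> nonneg_cone (inversions x \<union> ?A)" by (rule nonneg_cone_mono) auto
    then have "root_cone (inversions x \<union> inversions v) \<subseteq> root_cone (inversions x \<union> ?A)"
      unfolding v(2) by (intro root_cone_subset_cone) (auto simp: root_cone_def intro: nonneg_cone_base)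
    ultimately have "inversions w = root_cone (inversions x \<union> ?A)" unfolding w(2) by (rule equalityI[rotated])
    then show ?case using w(1) by (intro bexI[of _ w]) (simp_all only: UN_insert)
  qed
qed

text \<open>
By convexity, the upper bounds of \<open>X\<close> are the elements whose inversion set contains the root cone
of the union.
\<close>
theorem inversions_join:
  assumes "weakly_bounded X"
  shows "\<Squnion>\<^bsub>weak_order\<^esub> X \<in> carrier W \<and>
    inversions (\<Squnion>\<^bsub>weak_order\<^esub> X) = root_cone (\<Union>x\<in>X. inversions x)"
proof -
  note le = weak_order_iff_inversions
  have X: "X \<subseteq> carrier W" using assms unfolding weakly_bounded_def by auto
  obtain g where g: "g \<in> carrier W" "\<forall>x\<in>X. x \<sqsubseteq>\<^bsub>weak_order\<^esub> g" using assms unfolding weakly_bounded_def by auto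
  have "\<forall>x\<in>X. inversions x \<subseteq> inversions g"
  proof
    fix x assume "x \<in> X"
    then show "inversions x \<subseteq> inversions g" using g le[of x g] X by blast
  qed
  then obtain w where w: "w \<in> carrier W" "inversions w = root_cone (\<Union>x\<in>X. inversions x)"
    using inversion_set_of_bounded_union g(1) X by blast
  have Upper: "u \<in> Upper weak_order X \<longleftrightarrow> u \<in> carrier W \<and> inversions w \<subseteq> inversions u" for u
  proof -
    have "u \<in> Upper weak_order X \<longleftrightarrow> u \<in> carrier W \<and> (\<forall>x\<in>X. x \<sqsubseteq>\<^bsub>weak_order\<^esub> u)"
      using X unfolding Upper_def by (auto simp del: weak_order_simps(2))
    also have "\<dots> \<longleftrightarrow> u \<in> carrier W \<and> (\<forall>x\<in>X. inversions x \<subseteq> inversions u)"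
      by (intro conj_cong ball_cong refl le) (use X in auto)
    also have "\<dots> \<longleftrightarrow> u \<in> carrier W \<and> (\<Union>x\<in>X. inversions x) \<subseteq> inversions u" by blast
    also have "\<dots> \<longleftrightarrow> u \<in> carrier W \<and> inversions w \<subseteq> inversions u"
    proof -
      have "(\<Union>x\<in>X. inversions x) \<subseteq> root_cone (\<Union>x\<in>X. inversions x)"
        by (rule root_cone_base) (use inversions_root in blast)
      then show ?thesis unfolding w(2) using inversions_convex[of u "\<Union>x\<in>X. inversions x"] by blast
    qed
    finally show ?thesis .
  qed
  have "least weak_order w (Upper weak_order X)"
    unfolding least_def
  proof (intro conjI ballI subsetI)
    show "u \<in> carrier weak_order" if "u \<in> Upper weak_order X" for u using that Upper by simp
    show "w \<in> Upper weak_order X" using w(1) Upper by simp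
    show "w \<sqsubseteq>\<^bsub>weak_order\<^esub> u" if "u \<in> Upper weak_order X" for u using that Upper le[OF w(1)] by blast
  qed
  moreover have "v = w" if "least weak_order v (Upper weak_order X)" for v
  proof (rule inversions_inj[OF _ w(1)])
    have "w \<in> Upper weak_order X" using Upper w(1) by blast
    then have v: "v \<in> Upper weak_order X" "v \<sqsubseteq>\<^bsub>weak_order\<^esub> w"
      using that unfolding least_def by blast+
    then show vW: "v \<in> carrier W" using Upper by blast
    show "inversions v = inversions w" using v Upper le[OF vW w(1)] by blast
  qed
  ultimately have "\<Squnion>\<^bsub>weak_order\<^esub> X = w" unfolding sup_def by (rule some_equality)
  then show ?thesis using w by simp
qed

end

section \<open>The dominance order on positive roots\<close>

context geometric_representation
begin

text \<open>
The functional plays the part of the height of a root.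
\<close>
lemma positive_functional: "\<exists>f :: 'v \<Rightarrow> real. linear f \<and> (\<forall>\<beta>\<in>pos_roots. f \<beta> > 0)"
proof -
  obtain f :: "'v \<Rightarrow> real" where f: "linear f" "\<forall>s\<in>S. f (\<alpha> s) > 0"
    using positive_functional_exists[OF finite_gens simple_independent] by blast
  have "f \<beta> > 0" if b: "\<beta> \<in> pos_roots" for \<beta>
  proof -
    obtain c where c: "\<forall>s\<in>S. (c s :: real) \<ge> 0" "\<beta> = (\<Sum>s\<in>S. c s *\<^sub>R \<alpha> s)"
      using pos_root_cone[OF b] simple_cone_sum by auto
    have "\<beta> \<noteq> 0" using pos_root[OF b] by auto
    moreover have "\<beta> = 0" if "\<forall>s\<in>S. c s = 0" unfolding c(2) using that by simp
    ultimately obtain s where s: "s \<in> S" "c s \<noteq> 0" by blast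
    have "f \<beta> = (\<Sum>s\<in>S. c s * f (\<alpha> s))" using f(1) c(2) by (simp add: linear_sum linear_scale)
    also have "\<dots> > 0"
    proof (rule sum_pos2[of S s])
      show "0 < c s * f (\<alpha> s)" using s c(1) f(2) by (intro mult_pos_pos) (auto simp: less_le)
      show "0 \<le> c i * f (\<alpha> i)" if "i \<in> S" for i
        using that c(1) f(2) by (intro mult_nonneg_nonneg) (auto simp: less_le)
    qed (use s in auto)
    finally show ?thesis .
  qed
  then show ?thesis using f(1) by blast
qed

lemma root_reflection:
  assumes "\<beta> \<in> roots"
  obtains r where "r \<in> carrier W" "\<And>x. \<rho> r x = x - (2 * B \<beta> x) *\<^sub>R \<beta>"
proof -
  obtain w s where w: "w \<in> carrier W" "s \<in> S" "\<beta> = \<rho> w (\<alpha> s)" using assms roots_iff by auto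
  have "\<rho> (w \<otimes> s \<otimes> inv w) x = x - (2 * B \<beta> x) *\<^sub>R \<beta>" for x
  proof -
    have "B \<beta> x = B (\<alpha> s) (\<rho> (inv w) x)" using rho_form[of w "\<alpha> s" "\<rho> (inv w) x"] w by simp
    then show ?thesis using w by (simp add: reflection rho_simps)
  qed
  then show ?thesis using that[of "w \<otimes> s \<otimes> inv w"] w by auto
qed

lemma pos_roots_combination:
  assumes "x \<in> simple_cone" "y \<in> simple_cone" "p \<ge> 0" "q \<ge> 0" "p *\<^sub>R x + q *\<^sub>R y \<in> roots"
  shows "p *\<^sub>R x + q *\<^sub>R y \<in> pos_roots"
  using assms by (auto simp: pos_roots_iff intro!: nonneg_cone_add nonneg_cone_scale)

lemma dominance_iff:
  "dominance \<gamma> \<beta> \<longleftrightarrow> \<gamma> \<in> pos_roots \<and> \<beta> \<in> pos_roots \<and>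
     (\<forall>w\<in>carrier W. \<rho> w \<beta> \<notin> pos_roots \<longrightarrow> \<rho> w \<gamma> \<notin> pos_roots)"
proof -
  have "(\<forall>w\<in>carrier W. \<beta> \<in> inversions w \<longrightarrow> \<gamma> \<in> inversions w) \<longleftrightarrow>
    (\<forall>w\<in>carrier W. \<rho> w \<beta> \<notin> pos_roots \<longrightarrow> \<rho> w \<gamma> \<notin> pos_roots)"
    if "\<gamma> \<in> pos_roots" "\<beta> \<in> pos_roots"
  proof
    assume *: "\<forall>w\<in>carrier W. \<beta> \<in> inversions w \<longrightarrow> \<gamma> \<in> inversions w"
    show "\<forall>w\<in>carrier W. \<rho> w \<beta> \<notin> pos_roots \<longrightarrow> \<rho> w \<gamma> \<notin> pos_roots"
    proof (intro ballI impI)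
      fix w assume w: "w \<in> carrier W" "\<rho> w \<beta> \<notin> pos_roots"
      then show "\<rho> w \<gamma> \<notin> pos_roots"
        using *[rule_format, of "inv w"] that inversions_iff[of "inv w"] by simp
    qed
  next
    assume *: "\<forall>w\<in>carrier W. \<rho> w \<beta> \<notin> pos_roots \<longrightarrow> \<rho> w \<gamma> \<notin> pos_roots"
    show "\<forall>w\<in>carrier W. \<beta> \<in> inversions w \<longrightarrow> \<gamma> \<in> inversions w"
    proof (intro ballI impI)
      fix w assume w: "w \<in> carrier W" "\<beta> \<in> inversions w"
      then show "\<gamma> \<in> inversions w"
        using *[rule_format, of "inv w"] that inversions_iff[of w] by simp
    qed
  qed
  then show ?thesis unfolding dominance_def by blast
qed

lemma dominance_pos_roots: "dominance \<gamma> \<beta> \<Longrightarrow> \<gamma> \<in> pos_roots \<and> \<beta> \<in> pos_roots"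
  unfolding dominance_def by blast

lemma dominance_inversions:
  "dominance \<gamma> \<beta> \<Longrightarrow> w \<in> carrier W \<Longrightarrow> \<beta> \<in> inversions w \<Longrightarrow> \<gamma> \<in> inversions w"
  unfolding dominance_def by blast

lemma dominance_refl: "\<beta> \<in> pos_roots \<Longrightarrow> dominance \<beta> \<beta>"
  unfolding dominance_def by blast

lemma dominance_trans: "dominance \<gamma> \<beta> \<Longrightarrow> dominance \<delta> \<gamma> \<Longrightarrow> dominance \<delta> \<beta>"
  unfolding dominance_def by blast

text \<open>
Each positive root is the last inversion of some element.  This separates it from every other root and
yields antisymmetry of dominance.
\<close>
lemma pos_root_last_inversion:
  assumes "\<beta> \<in> pos_roots"
  obtains u s where "u \<in> carrier W" "s \<in> S" "inversions (u \<otimes> s) = insert \<beta> (inversions u)" "\<beta> \<notin> inversions u"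
proof -
  obtain u s where u: "u \<in> carrier W" "s \<in> S" "\<beta> = \<rho> u (\<alpha> s)" using assms roots_iff pos_root by metis
  have "inversions (u \<otimes> s) = insert \<beta> (inversions u)" using inversions_mult_gen[of u s] u assms by simp
  moreover have "\<beta> \<notin> inversions u" using u by (simp add: inversions_iff)
  ultimately show ?thesis using that u by blast
qed

lemma dominance_antisym:
  assumes "dominance \<gamma> \<beta>" "dominance \<beta> \<gamma>"
  shows "\<gamma> = \<beta>"
proof -
  have "\<beta> \<in> pos_roots" using dominance_pos_roots assms by blast+
  then obtain u s where u: "u \<in> carrier W" "s \<in> S" "inversions (u \<otimes> s) = insert \<beta> (inversions u)"
      "\<beta> \<notin> inversions u"
    using pos_root_last_inversion by blast
  then have "\<gamma> \<in> inversions (u \<otimes> s)" using dominance_inversions[OF assms(1), of "u \<otimes> s"] by simp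
  moreover have "\<gamma> \<notin> inversions u" using dominance_inversions[OF assms(2) u(1)] u(4) by blast
  ultimately show ?thesis using u(3) by blast
qed

definition dominated :: "'v \<Rightarrow> 'v set" where
  "dominated \<beta> = {\<gamma> \<in> pos_roots. dominance \<gamma> \<beta> \<and> \<gamma> \<noteq> \<beta>}"

lemma dominated_iff: "\<gamma> \<in> dominated \<beta> \<longleftrightarrow> dominance \<gamma> \<beta> \<and> \<gamma> \<noteq> \<beta>"
  unfolding dominated_def dominance_def by auto

lemma finite_dominated [simp]: "\<beta> \<in> pos_roots \<Longrightarrow> finite (dominated \<beta>)"
proof -
  assume "\<beta> \<in> pos_roots"
  then obtain u s where "u \<in> carrier W" "s \<in> S" "inversions (u \<otimes> s) = insert \<beta> (inversions u)"
    using pos_root_last_inversion by metis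
  then have "dominated \<beta> \<subseteq> inversions (u \<otimes> s)" "finite (inversions (u \<otimes> s))"
    using dominance_inversions[of _ \<beta> "u \<otimes> s"] unfolding dominated_def by auto
  then show ?thesis by (rule finite_subset)
qed

lemma small_roots_iff: "\<beta> \<in> small_roots n \<longleftrightarrow> \<beta> \<in> pos_roots \<and> card (dominated \<beta>) \<le> n"
  unfolding small_roots_def inf_depth_def dominated_def[symmetric] Let_def by auto

text \<open>
Test dominance on the reflection in \<open>\<beta>\<close>: it makes \<open>\<beta>\<close> negative, but for \<open>B(\<gamma>, \<beta>) \<le> 0\<close> it maps
\<open>\<gamma>\<close> to a nonnegative combination of \<open>\<gamma>\<close> and \<open>\<beta>\<close>.
\<close>
lemma dominance_form_pos:
  assumes "dominance \<gamma> \<beta>"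
  shows "B \<gamma> \<beta> > 0"
proof (rule ccontr)
  assume neg: "\<not> B \<gamma> \<beta> > 0"
  have pos: "\<gamma> \<in> pos_roots" "\<beta> \<in> pos_roots" using dominance_pos_roots assms by blast+
  obtain r where r: "r \<in> carrier W" "\<And>x. \<rho> r x = x - (2 * B \<beta> x) *\<^sub>R \<beta>"
    using root_reflection pos pos_root by metis
  have "\<rho> r \<beta> = (1 - 2) *\<^sub>R \<beta>" unfolding r(2) using pos root_unit[of \<beta>] by (simp add: scaleR_2)
  then have "\<rho> r \<beta> \<notin> pos_roots" using pos by (simp add: uminus_pos_root)
  then have "\<rho> r \<gamma> \<notin> pos_roots" using assms r(1) unfolding dominance_iff by blast
  moreover have "\<rho> r \<gamma> = 1 *\<^sub>R \<gamma> + (- 2 * B \<gamma> \<beta>) *\<^sub>R \<beta>" using form(2)[of \<beta> \<gamma>] by (simp add: r(2))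
  moreover have "\<rho> r \<gamma> \<in> roots" using r(1) pos by simp
  ultimately show False using pos_roots_combination[of \<gamma> \<beta> 1 "- 2 * B \<gamma> \<beta>"] pos pos_root_cone neg by simp
qed

text \<open>
If \<open>B(\<gamma>, \<beta>) \<le> -1\<close>, the reflections in \<open>\<gamma>\<close> and \<open>\<beta>\<close> generate infinitely many roots in the cone
over \<open>\<gamma>\<close> and \<open>\<beta>\<close>, while an inversion set is finite and convex.  The contradiction comes from a root of
maximal height in this cone: reflecting it in the one of \<open>\<gamma>\<close>, \<open>\<beta>\<close> with the smaller coefficient
increases that coefficient.
\<close>
lemma inversions_form_gt:
  assumes "w \<in> carrier W" "\<gamma> \<in> inversions w" "\<beta> \<in> inversions w"
  shows "B \<gamma> \<beta> > - 1"
proof (rule ccontr)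
  assume "\<not> B \<gamma> \<beta> > - 1"
  define b where "b = - B \<gamma> \<beta>"
  have b: "b \<ge> 1" using \<open>\<not> B \<gamma> \<beta> > - 1\<close> by (simp add: b_def)
  have sym: "B \<beta> \<gamma> = - b" "B \<gamma> \<beta> = - b" using form(2)[of \<beta> \<gamma>] by (simp_all add: b_def)
  have pos: "\<gamma> \<in> pos_roots" "\<beta> \<in> pos_roots" using assms inversions_pos by auto
  have unit: "B \<gamma> \<gamma> = 1" "B \<beta> \<beta> = 1" using pos root_unit by auto
  obtain f :: "'v \<Rightarrow> real" where f: "linear f" "\<forall>\<beta>\<in>pos_roots. f \<beta> > 0"
    using positive_functional by blast
  define T where "T = {x \<in> inversions w. \<exists>p\<ge>0. \<exists>q\<ge>0. x = p *\<^sub>R \<gamma> + q *\<^sub>R \<beta>}"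
  have dbl: "r *\<^sub>R v + r *\<^sub>R v = (r * 2) *\<^sub>R v" for r and v :: 'v
    by (simp add: scaleR_left_distrib[symmetric])
  have "finite T" unfolding T_def using assms by simp
  have "\<gamma> \<in> T" unfolding T_def using assms(2)
    by (intro CollectI conjI exI[of _ 1] exI[of _ 0]) auto
  have step: "\<exists>y\<in>T. f y > f x" if "x \<in> T" for x
  proof -
    have x: "x \<in> inversions w" and ex: "\<exists>p\<ge>0. \<exists>q\<ge>0. x = p *\<^sub>R \<gamma> + q *\<^sub>R \<beta>"
      using that unfolding T_def by simp_all
    from ex obtain p q where pq: "p \<ge> 0" "q \<ge> 0" "x = p *\<^sub>R \<gamma> + q *\<^sub>R \<beta>" by (elim exE conjE)
    have "B x x = 1" using x inversions_pos root_unit by auto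
    then have norm: "p * p + q * q - 2 * b * p * q = 1"
      unfolding pq(3) by (simp add: form_simps sym unit algebra_simps)
    \<comment> \<open>Equality in the estimates below would mean \<open>p = q = b p\<close>, and then \<open>B x x = 0\<close>, while \<open>x\<close> is a unit vector.\<close>
    have ne: "\<not> (b * m = n \<and> m \<ge> n \<and> {m, n} = {p, q})" if "m \<ge> 0" for m n
    proof
      assume A: "b * m = n \<and> m \<ge> n \<and> {m, n} = {p, q}"
      then have "b * m \<ge> 1 * m" using b that by (intro mult_right_mono) auto
      then have "m = n" using A by linarith
      then have "p = q" "b * p = p" using A by (auto simp: doubleton_eq_iff)
      then have "p * p + q * q - 2 * b * p * q = 0" by (simp add: algebra_simps)
      then show False using norm by simp
    qed
    have inT: "y \<in> T" if y: "y \<in> roots" "y = p' *\<^sub>R \<gamma> + q' *\<^sub>R \<beta>" "p' \<ge> 0" "q' \<ge> 0" for y p' q'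
    proof -
      have "y \<in> root_cone {\<gamma>, \<beta>}" unfolding root_cone_def
        using y by (auto intro!: nonneg_cone_add nonneg_cone_scale intro: nonneg_cone_base)
      then have "y \<in> inversions w" using inversions_convex[OF assms(1), of "{\<gamma>, \<beta>}"] assms by auto
      then show ?thesis unfolding T_def using y by auto
    qed
    show ?thesis
    proof (cases "q \<le> p")
      case True
      obtain r where r: "r \<in> carrier W" "\<And>x. \<rho> r x = x - (2 * B \<beta> x) *\<^sub>R \<beta>"
        using root_reflection pos pos_root by metis
      have y: "\<rho> r x = p *\<^sub>R \<gamma> + (2 * b * p - q) *\<^sub>R \<beta>"
        unfolding r(2) by (simp add: pq(3) form_simps sym unit algebra_simps dbl)
      have "b * p \<ge> 1 * p" using b pq by (intro mult_right_mono) auto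
      moreover have "\<not> (b * p = q)" using ne[of p q] pq True by auto
      ultimately have g: "2 * b * p - q > q" using True by linarith
      then have "\<rho> r x \<in> T" using inT[OF _ y] pq r(1) x inversions_pos by auto
      moreover have "f (\<rho> r x) = p * f \<gamma> + (2 * b * p - q) * f \<beta>" unfolding y
        using f(1) by (simp add: linear_add linear_scale)
      moreover have "f x = p * f \<gamma> + q * f \<beta>" unfolding pq(3)
        using f(1) by (simp add: linear_add linear_scale)
      moreover have "q * f \<beta> < (2 * b * p - q) * f \<beta>" using g f(2) pos(2) by simp
      ultimately show ?thesis by (intro bexI[of _ "\<rho> r x"]) simp_all
    next
      case False
      obtain r where r: "r \<in> carrier W" "\<And>x. \<rho> r x = x - (2 * B \<gamma> x) *\<^sub>R \<gamma>"
        using root_reflection pos pos_root by metis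
      have y: "\<rho> r x = (2 * b * q - p) *\<^sub>R \<gamma> + q *\<^sub>R \<beta>"
        unfolding r(2) by (simp add: pq(3) form_simps sym unit algebra_simps dbl)
      have "b * q \<ge> 1 * q" using b pq by (intro mult_right_mono) auto
      then have g: "2 * b * q - p > p" using False by linarith
      then have "\<rho> r x \<in> T" using inT[OF _ y] pq r(1) x inversions_pos by auto
      moreover have "f (\<rho> r x) = (2 * b * q - p) * f \<gamma> + q * f \<beta>" unfolding y
        using f(1) by (simp add: linear_add linear_scale)
      moreover have "f x = p * f \<gamma> + q * f \<beta>" unfolding pq(3)
        using f(1) by (simp add: linear_add linear_scale)
      moreover have "p * f \<gamma> < (2 * b * q - p) * f \<gamma>" using g f(2) pos(1) by simp
      ultimately show ?thesis by (intro bexI[of _ "\<rho> r x"]) simp_all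
    qed
  qed
  have "Max (f ` T) \<in> f ` T" using \<open>finite T\<close> \<open>\<gamma> \<in> T\<close> by (intro Max_in) auto
  then obtain x where x: "Max (f ` T) = f x" "x \<in> T" by (rule imageE)
  obtain y where "y \<in> T" "f y > f x" using step[OF x(2)] by blast
  moreover have "f y \<le> Max (f ` T)" using \<open>finite T\<close> \<open>y \<in> T\<close> by simp
  ultimately show False unfolding x(1) by simp
qed

text \<open>
If neither root dominates the other, some \<open>x\<close> makes only \<open>\<beta>\<close> negative and some \<open>y\<close> only \<open>\<gamma>\<close>.
Then \<open>x \<gamma>\<close> and \<open>-x \<beta>\<close> are both inversions of \<open>x y\<^sup>-\<^sup>1\<close>, with form value at most \<open>-1\<close>.
\<close>
lemma dominance_comparable:
  assumes "\<gamma> \<in> pos_roots" "\<beta> \<in> pos_roots" "B \<gamma> \<beta> \<ge> 1"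
  shows "dominance \<gamma> \<beta> \<or> dominance \<beta> \<gamma>"
proof (rule ccontr)
  assume "\<not> ?thesis"
  then obtain x y where x: "x \<in> carrier W" "\<rho> x \<beta> \<notin> pos_roots" "\<rho> x \<gamma> \<in> pos_roots"
    and y: "y \<in> carrier W" "\<rho> y \<gamma> \<notin> pos_roots" "\<rho> y \<beta> \<in> pos_roots"
    using assms unfolding dominance_iff by blast
  let ?w = "x \<otimes> inv y"
  have w: "?w \<in> carrier W" "\<rho> (inv ?w) (\<rho> x v) = \<rho> y v" for v using x y by (simp_all add: inv_mult_group)
  have 1: "\<rho> x \<gamma> \<in> inversions ?w" using inversions_iff[OF w(1)] w(2) x y by simp
  have "- \<rho> x \<beta> \<in> pos_roots" using x assms by (simp add: uminus_pos_root)
  moreover have "\<rho> (inv ?w) (- \<rho> x \<beta>) = - \<rho> y \<beta>" using w rho_simps(4)[of "inv ?w"] by simp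
  ultimately have 2: "- \<rho> x \<beta> \<in> inversions ?w"
    using inversions_iff[OF w(1)] y assms by (simp add: uminus_pos_root)
  have "B (\<rho> x \<gamma>) (- \<rho> x \<beta>) \<le> - 1" using x assms by (simp add: form_simps)
  then show False using inversions_form_gt[OF w(1) 1 2] by simp
qed

text \<open>
The roots of \<open>\<infinity>\<close>-depth \<open>0\<close>, that is, the set of \<open>0\<close>-small roots.
\<close>
definition elementary_roots :: "'v set" where
  "elementary_roots = {\<beta> \<in> pos_roots. dominated \<beta> = {}}"

lemma elementary_rootsD: "\<alpha>\<^sub>0 \<in> elementary_roots \<Longrightarrow> dominance \<gamma> \<alpha>\<^sub>0 \<Longrightarrow> \<gamma> = \<alpha>\<^sub>0"
  unfolding elementary_roots_def using dominated_iff by blast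

lemma elementary_root_below:
  assumes "\<beta> \<in> pos_roots"
  shows "\<exists>\<alpha>\<^sub>0\<in>elementary_roots. dominance \<alpha>\<^sub>0 \<beta>"
  using assms
proof (induct "card (dominated \<beta>)" arbitrary: \<beta> rule: less_induct)
  case less
  show ?case
  proof (cases "dominated \<beta> = {}")
    case True
    then have "\<beta> \<in> elementary_roots" using less.prems unfolding elementary_roots_def by simp
    then show ?thesis using dominance_refl less.prems by blast
  next
    case False
    then obtain \<gamma> where g: "dominance \<gamma> \<beta>" "\<gamma> \<noteq> \<beta>" by (auto simp: dominated_iff)
    then have gp: "\<gamma> \<in> pos_roots" using dominance_pos_roots by blast
    have "dominated \<gamma> \<subseteq> dominated \<beta>"
      using g dominance_trans dominance_antisym unfolding subset_iff dominated_iff by blast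
    moreover have "\<gamma> \<in> dominated \<beta>" "\<gamma> \<notin> dominated \<gamma>" using g by (simp_all add: dominated_iff)
    ultimately have "dominated \<gamma> \<subset> dominated \<beta>" by blast
    then have "card (dominated \<gamma>) < card (dominated \<beta>)" using less by (intro psubset_card_mono) auto
    then show ?thesis using less.hyps[OF _ gp] g dominance_trans by blast
  qed
qed

text \<open>
The reflection \<open>r\<close> in \<open>\<alpha>\<^sub>0\<close> respects dominance as long as roots stay positive.  The image of \<open>\<beta>\<close>
is positive, since otherwise its negative would be another root dominated by \<open>\<alpha>\<^sub>0\<close>.  A root dominated
by \<open>r \<beta>\<close> is sent by \<open>r\<close> to a root dominated by \<open>\<beta>\<close> if it stays positive, and is itself dominated by
\<open>\<beta>\<close> if it does not.  This is an injection into the roots dominated by \<open>\<beta>\<close> that misses \<open>\<alpha>\<^sub>0\<close>.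
\<close>
lemma dominated_card_reflect:
  assumes "\<alpha>\<^sub>0 \<in> elementary_roots" "dominance \<alpha>\<^sub>0 \<beta>" "\<alpha>\<^sub>0 \<noteq> \<beta>"
    and r: "r \<in> carrier W" "\<And>x. \<rho> r x = x - (2 * B \<alpha>\<^sub>0 x) *\<^sub>R \<alpha>\<^sub>0"
  shows "\<rho> r \<beta> \<in> pos_roots" "card (dominated (\<rho> r \<beta>)) < card (dominated \<beta>)"
proof -
  have pos: "\<alpha>\<^sub>0 \<in> pos_roots" "\<beta> \<in> pos_roots" using dominance_pos_roots assms by blast+
  have ra: "\<rho> r \<alpha>\<^sub>0 = - \<alpha>\<^sub>0" using r(2)[of \<alpha>\<^sub>0] pos root_unit[of \<alpha>\<^sub>0] by (simp add: scaleR_2)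
  have rr: "\<rho> r (\<rho> r x) = x" for x
  proof -
    have "B \<alpha>\<^sub>0 (\<rho> r x) = - B \<alpha>\<^sub>0 x" using r(2) root_unit[of \<alpha>\<^sub>0] pos by (simp add: form_simps)
    then show ?thesis using r(2)[of "\<rho> r x"] r(2)[of x] by simp
  qed
  have neg: "\<rho> w (- x) \<notin> pos_roots \<longleftrightarrow> \<rho> w x \<in> pos_roots" if "x \<in> roots" "w \<in> carrier W" for w x
    using that by (simp add: rho_simps uminus_pos_root)
  have dom: "\<rho> w \<alpha>\<^sub>0 \<notin> pos_roots" if "w \<in> carrier W" "\<rho> w \<beta> \<notin> pos_roots" for w
    using that assms(2) dominance_iff by blast
  show bp: "\<rho> r \<beta> \<in> pos_roots"
  proof (rule ccontr)
    assume n: "\<rho> r \<beta> \<notin> pos_roots"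
    then have d: "- \<rho> r \<beta> \<in> pos_roots" using pos r(1) by (simp add: uminus_pos_root)
    have "\<rho> w (- \<rho> r \<beta>) \<notin> pos_roots" if w: "w \<in> carrier W" "\<rho> w \<alpha>\<^sub>0 \<notin> pos_roots" for w
    proof -
      have "\<rho> (w \<otimes> r) \<alpha>\<^sub>0 \<in> pos_roots" using w r(1) ra neg[of \<alpha>\<^sub>0 w] pos by (simp add: rho_simps uminus_pos_root)
      then have "\<rho> (w \<otimes> r) \<beta> \<in> pos_roots" using dom[of "w \<otimes> r"] w(1) r(1) by blast
      then show ?thesis using neg[of "\<rho> r \<beta>" w] w r(1) pos by simp
    qed
    then have "dominance (- \<rho> r \<beta>) \<alpha>\<^sub>0" using d pos unfolding dominance_iff by blast
    then have "- \<rho> r \<beta> = \<alpha>\<^sub>0" using elementary_rootsD assms(1) by blast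
    then have "\<rho> r \<beta> = \<rho> r \<alpha>\<^sub>0" using ra by (metis minus_minus)
    then show False using assms(3) r(1) by simp
  qed
  \<comment> \<open>The injection from the roots dominated by \<open>r \<beta>\<close> to those dominated by \<open>\<beta>\<close>.\<close>
  define \<phi> where "\<phi> \<gamma> = (if \<rho> r \<gamma> \<in> pos_roots then \<rho> r \<gamma> else \<gamma>)" for \<gamma>
  have "inj_on \<phi> (dominated (\<rho> r \<beta>))"
  proof (rule inj_onI)
    fix x y assume "x \<in> dominated (\<rho> r \<beta>)" "y \<in> dominated (\<rho> r \<beta>)" and e: "\<phi> x = \<phi> y"
    then have "x \<in> pos_roots" "y \<in> pos_roots" unfolding dominated_def by auto
    then show "x = y" using e rr r(1) unfolding \<phi>_def by (metis rho_eq_iff)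
  qed
  moreover have "\<phi> ` dominated (\<rho> r \<beta>) \<subseteq> dominated \<beta> - {\<alpha>\<^sub>0}"
  proof (rule image_subsetI)
    fix \<gamma> assume "\<gamma> \<in> dominated (\<rho> r \<beta>)"
    then have g: "dominance \<gamma> (\<rho> r \<beta>)" "\<gamma> \<noteq> \<rho> r \<beta>" "\<gamma> \<in> pos_roots" unfolding dominated_def by auto
    have g': "\<rho> w (\<rho> r \<gamma>) \<notin> pos_roots" if "w \<in> carrier W" "\<rho> w \<beta> \<notin> pos_roots" for w
    proof -
      have "\<rho> (w \<otimes> r) (\<rho> r \<beta>) \<notin> pos_roots" using that r(1) rr by simp
      then have "\<rho> (w \<otimes> r) \<gamma> \<notin> pos_roots" using g(1) that r(1) m_closed unfolding dominance_iff by blast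
      then show ?thesis using that r(1) by simp
    qed
    show "\<phi> \<gamma> \<in> dominated \<beta> - {\<alpha>\<^sub>0}"
    proof (cases "\<rho> r \<gamma> \<in> pos_roots")
      case True
      have "dominance (\<rho> r \<gamma>) \<beta>" using g' True pos unfolding dominance_iff by blast
      moreover have "\<rho> r \<gamma> \<noteq> \<beta>" using g rr by metis
      moreover have "\<rho> r \<gamma> \<noteq> \<alpha>\<^sub>0"
      proof
        assume "\<rho> r \<gamma> = \<alpha>\<^sub>0"
        then have "\<gamma> = - \<alpha>\<^sub>0" using rr ra by metis
        then show False using g pos by (simp add: uminus_pos_root)
      qed
      ultimately show ?thesis using True by (simp add: \<phi>_def dominated_iff)
    next
      case False
      have b: "B \<alpha>\<^sub>0 \<gamma> > 0"
      proof (rule ccontr)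
        assume "\<not> ?thesis"
        moreover have "\<rho> r \<gamma> = 1 *\<^sub>R \<gamma> + (- 2 * B \<alpha>\<^sub>0 \<gamma>) *\<^sub>R \<alpha>\<^sub>0" by (simp add: r(2))
        moreover have "\<rho> r \<gamma> \<in> roots" using g r(1) by simp
        ultimately show False
          using False pos_roots_combination[of \<gamma> \<alpha>\<^sub>0 1 "- 2 * B \<alpha>\<^sub>0 \<gamma>"] g pos pos_root_cone by simp
      qed
      have "\<rho> w \<gamma> \<notin> pos_roots" if w: "w \<in> carrier W" "\<rho> w \<beta> \<notin> pos_roots" for w
      proof
        assume p: "\<rho> w \<gamma> \<in> pos_roots"
        have 1: "- \<rho> w \<alpha>\<^sub>0 \<in> pos_roots" using dom[OF w] pos w by (simp add: uminus_pos_root)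
        have "\<rho> w (\<rho> r \<gamma>) = 1 *\<^sub>R \<rho> w \<gamma> + (2 * B \<alpha>\<^sub>0 \<gamma>) *\<^sub>R (- \<rho> w \<alpha>\<^sub>0)"
          using w by (simp add: r(2) rho_simps)
        moreover have "\<rho> w (\<rho> r \<gamma>) \<in> roots" using g w r(1) by simp
        ultimately have "\<rho> w (\<rho> r \<gamma>) \<in> pos_roots"
          using pos_roots_combination[OF pos_root_cone[OF p] pos_root_cone[OF 1], of 1 "2 * B \<alpha>\<^sub>0 \<gamma>"] b by simp
        then show False using g'[OF w] by simp
      qed
      then have "dominance \<gamma> \<beta>" using g pos unfolding dominance_iff by blast
      moreover have "\<gamma> \<noteq> \<beta>" using False bp by auto
      moreover have "\<gamma> \<noteq> \<alpha>\<^sub>0"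
      proof
        assume "\<gamma> = \<alpha>\<^sub>0"
        then have "B \<alpha>\<^sub>0 (\<rho> r \<beta>) > 0" using dominance_form_pos g(1) by blast
        moreover have "B \<alpha>\<^sub>0 (\<rho> r \<beta>) = - B \<alpha>\<^sub>0 \<beta>"
          using root_unit[of \<alpha>\<^sub>0] pos by (simp add: r(2) form_simps)
        moreover have "B \<alpha>\<^sub>0 \<beta> > 0" using dominance_form_pos assms(2) by blast
        ultimately show False by simp
      qed
      ultimately show ?thesis using False by (simp add: \<phi>_def dominated_iff)
    qed
  qed
  ultimately have "card (dominated (\<rho> r \<beta>)) \<le> card (dominated \<beta> - {\<alpha>\<^sub>0})"
    using pos by (intro card_inj_on_le[of \<phi>]) auto
  also have "\<dots> < card (dominated \<beta>)"
    using pos assms(2,3) card_Diff1_less[of "dominated \<beta>" "\<alpha>\<^sub>0"] by (simp add: dominated_iff)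
  finally show "card (dominated (\<rho> r \<beta>)) < card (dominated \<beta>)" .
qed

text \<open>
Every root that is \<open>(n + 1)\<close>-small but not elementary is the image of an \<open>n\<close>-small root under a
reflection in an elementary root.
\<close>
theorem finite_small_roots_if_finite_elementary:
  assumes "finite elementary_roots"
  shows "finite (small_roots n)"
proof (induct n)
  case 0
  have "small_roots 0 \<subseteq> elementary_roots"
    using finite_dominated unfolding elementary_roots_def by (auto simp: small_roots_iff)
  then show ?case using assms finite_subset by blast
next
  case (Suc n)
  let ?h = "\<lambda>(a, b). b - (2 * B a b) *\<^sub>R a"
  have "small_roots (Suc n) \<subseteq> elementary_roots \<union> ?h ` (elementary_roots \<times> small_roots n)"
  proof
    fix \<beta> assume "\<beta> \<in> small_roots (Suc n)"
    then have b: "\<beta> \<in> pos_roots" "card (dominated \<beta>) \<le> Suc n" by (auto simp: small_roots_iff)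
    obtain a where a: "a \<in> elementary_roots" "dominance a \<beta>" using elementary_root_below b by blast
    show "\<beta> \<in> elementary_roots \<union> ?h ` (elementary_roots \<times> small_roots n)"
    proof (cases "a = \<beta>")
      case True
      then show ?thesis using a by auto
    next
      case False
      have ap: "a \<in> pos_roots" using dominance_pos_roots a by blast
      obtain r where r: "r \<in> carrier W" "\<And>x. \<rho> r x = x - (2 * B a x) *\<^sub>R a"
        using root_reflection ap pos_root by metis
      have "\<rho> r \<beta> \<in> small_roots n"
        using dominated_card_reflect[OF a False r] b by (simp add: small_roots_iff)
      moreover have "\<beta> = ?h (a, \<rho> r \<beta>)"
        using ap root_unit[of a] by (simp add: r(2) form_simps)
      ultimately have "\<beta> \<in> ?h ` (elementary_roots \<times> small_roots n)" using a(1) by (intro image_eqI) auto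
      then show ?thesis by blast
    qed
  qed
  then show ?case using Suc assms by (meson finite_UnI finite_imageI finite_SigmaI finite_subset)
qed

end

section \<open>Finitely many form values between -1 and 1\<close>

text \<open>
The recurrence of a rotation.  For \<open>d < 2\<close> a positive solution would have strictly decreasing
increments.  These can never be negative, or the sequence would become negative; so the sequence
stays above \<open>x 0\<close>, and then the increments decrease at least linearly after all.
\<close>
lemma no_positive_strictly_concave_sequence:
  fixes x :: "nat \<Rightarrow> real"
  assumes pos: "\<And>k. x k > 0" and rec: "\<And>k. x (Suc (Suc k)) = d * x (Suc k) - x k" and "d < 2"
  shows False
proof -
  define y where "y k = x (Suc k) - x k" for k
  have y: "y (Suc k) = y k - (2 - d) * x (Suc k)" for k by (simp add: y_def rec algebra_simps)
  have small: "\<exists>n. a + real n * e < 0" if e: "e < 0" for a e :: real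
  proof -
    obtain n where "a < real n * (- e)" using reals_Archimedean3[of "- e"] e by auto
    then show ?thesis by (intro exI[of _ n]) simp
  qed
  have dec: "y (Suc k) \<le> y k" for k using y pos[of "Suc k"] \<open>d < 2\<close> by (simp add: less_le)
  have y_nonneg: "y j \<ge> 0" for j
  proof (rule ccontr)
    assume "\<not> y j \<ge> 0"
    have yj: "y (j + n) \<le> y j" for n by (induct n) (auto intro: order_trans[OF dec])
    have "x (j + n) \<le> x j + real n * y j" for n
    proof (induct n)
      case (Suc n)
      have "x (j + Suc n) = x (j + n) + y (j + n)" by (simp add: y_def)
      then show ?case using Suc yj[of n] by (simp add: algebra_simps)
    qed simp
    moreover obtain n where "x j + real n * y j < 0" using small \<open>\<not> y j \<ge> 0\<close> by (meson not_le)
    ultimately show False using pos[of "j + n"] by (meson less_asym' order_le_less_trans)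
  qed
  have x0: "x 0 \<le> x n" for n
  proof (induct n)
    case (Suc n)
    then show ?case using y_nonneg[of n] by (simp add: y_def)
  qed simp
  have "y n \<le> y 0 + real n * (- ((2 - d) * x 0))" for n
  proof (induct n)
    case (Suc n)
    have "(2 - d) * x 0 \<le> (2 - d) * x (Suc n)" using x0 \<open>d < 2\<close> by (intro mult_left_mono) auto
    then show ?case using Suc y[of n] by (simp add: algebra_simps)
  qed simp
  moreover have "- ((2 - d) * x 0) < 0" using pos[of 0] \<open>d < 2\<close> by simp
  then obtain n where "y 0 + real n * (- ((2 - d) * x 0)) < 0" using small by blast
  ultimately show False using y_nonneg[of n] by (meson not_le order_le_less_trans)
qed

context geometric_representation
begin

text \<open>
The product \<open>w\<close> of the two reflections acts on the plane of \<open>\<alpha>\<^sub>0\<close> and \<open>\<beta>\<close> as a rotation.  Suppose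
that the roots \<open>w\<^sup>k \<beta>\<close> are all distinct.  Since \<open>w\<close> changes the sign of finitely many roots only, they
eventually all have the same sign.  But the heights of the iterates of a rotation cannot stay
positive.
\<close>
lemma rotation_finite_order:
  assumes "\<alpha>\<^sub>0 \<in> roots" "\<beta> \<in> roots" "\<bar>B \<alpha>\<^sub>0 \<beta>\<bar> < 1"
    and ra: "ra \<in> carrier W" "\<And>x. \<rho> ra x = x - (2 * B \<alpha>\<^sub>0 x) *\<^sub>R \<alpha>\<^sub>0"
    and rb: "rb \<in> carrier W" "\<And>x. \<rho> rb x = x - (2 * B \<beta> x) *\<^sub>R \<beta>"
  shows "\<exists>m>0. \<rho> ((ra \<otimes> rb) [^] (m::nat)) \<beta> = \<beta>"
proof (rule ccontr)
  assume none: "\<not> ?thesis"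
  define w where "w = ra \<otimes> rb"
  define b where "b = B \<alpha>\<^sub>0 \<beta>"
  define v where "v k = \<rho> (w [^] (k::nat)) \<beta>" for k
  have w: "w \<in> carrier W" using ra rb by (simp add: w_def)
  have vr: "v k \<in> roots" for k using w assms by (simp add: v_def)
  have vS: "v (Suc k) = \<rho> w (v k)" for k
  proof -
    have "v (Suc k) = \<rho> (w \<otimes> w [^] k) \<beta>" unfolding v_def nat_pow_Suc2[OF w] ..
    then show ?thesis using w by (simp add: v_def)
  qed
  have inj: "inj v"
  proof (rule linorder_injI)
    fix i j :: nat assume "i < j"
    then obtain m where m: "j = i + m" "m > 0" using less_imp_add_positive by blast
    show "v i \<noteq> v j"
    proof
      assume "v i = v j"
      then have "\<rho> (w [^] i) \<beta> = \<rho> (w [^] i) (\<rho> (w [^] m) \<beta>)"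
        using w m by (simp add: v_def nat_pow_mult[symmetric])
      then have "\<rho> (w [^] m) \<beta> = \<beta>" using w by simp
      then show False using none m unfolding w_def by blast
    qed
  qed
  have unit: "B \<beta> \<beta> = 1" "B \<alpha>\<^sub>0 \<alpha>\<^sub>0 = 1" and sym: "B \<beta> \<alpha>\<^sub>0 = b" "B \<alpha>\<^sub>0 \<beta> = b"
    using root_unit assms form(2)[of \<beta> \<alpha>\<^sub>0] by (simp_all add: b_def)
  have wx: "\<rho> w x = \<rho> ra (\<rho> rb x)" for x using ra(1) rb(1) by (simp add: w_def)
  have wb: "\<rho> w \<beta> = (2 * b) *\<^sub>R \<alpha>\<^sub>0 - \<beta>"
    unfolding wx ra(2) rb(2) by (simp add: form_simps unit sym scaleR_2)
  have wa: "\<rho> w \<alpha>\<^sub>0 = (4 * b\<^sup>2 - 1) *\<^sub>R \<alpha>\<^sub>0 - (2 * b) *\<^sub>R \<beta>"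
    unfolding wx ra(2) rb(2) by (simp add: form_simps unit sym algebra_simps power2_eq_square) (simp add: scaleR_2[symmetric])
  have rec0: "\<rho> w (\<rho> w \<beta>) = (4 * b\<^sup>2 - 2) *\<^sub>R \<rho> w \<beta> - \<beta>"
  proof -
    have "\<rho> w (\<rho> w \<beta>) = (2 * b) *\<^sub>R \<rho> w \<alpha>\<^sub>0 - \<rho> w \<beta>" using arg_cong[OF wb, of "\<rho> w"] w by (simp add: rho_simps)
    also have "\<dots> = (4 * b\<^sup>2 - 2) *\<^sub>R \<rho> w \<beta> - \<beta>"
      unfolding wa wb by (simp add: algebra_simps power2_eq_square) (simp add: scaleR_2 mult.commute scaleR_left_distrib[symmetric])
    finally show ?thesis .
  qed
  have rec: "v (Suc (Suc k)) = (4 * b\<^sup>2 - 2) *\<^sub>R v (Suc k) - v k" for k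
  proof (induct k)
    case 0
    have "v 0 = \<beta>" by (simp add: v_def)
    then show ?case using rec0 by (simp add: vS)
  next
    case (Suc k)
    have "v (Suc (Suc (Suc k))) = \<rho> w ((4 * b\<^sup>2 - 2) *\<^sub>R v (Suc k) - v k)" using Suc vS by metis
    then show ?case using w by (simp add: rho_simps vS)
  qed
  have d: "4 * b\<^sup>2 - 2 < 2" using assms(3) by (simp add: b_def abs_square_less_1)
  obtain f :: "'v \<Rightarrow> real" where f: "linear f" "\<forall>\<beta>\<in>pos_roots. f \<beta> > 0"
    using positive_functional by blast
  let ?C = "{k. (v k \<in> pos_roots) \<noteq> (v (Suc k) \<in> pos_roots)}"
  have "v ` ?C \<subseteq> inversions (inv w) \<union> uminus ` inversions (inv w)"
  proof (rule image_subsetI)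
    fix k assume "k \<in> ?C"
    then have k: "(v k \<in> pos_roots) \<noteq> (\<rho> w (v k) \<in> pos_roots)" by (simp add: vS)
    show "v k \<in> inversions (inv w) \<union> uminus ` inversions (inv w)"
    proof (cases "v k \<in> pos_roots")
      case True
      then have "\<rho> w (v k) \<notin> pos_roots" using k by blast
      then have "v k \<in> inversions (inv w)" using True w inversions_iff[of "inv w" "v k"] by simp
      then show ?thesis by blast
    next
      case False
      then have "- v k \<in> pos_roots" "\<rho> w (v k) \<in> pos_roots" using k vr uminus_pos_root by blast+
      then have "- v k \<in> inversions (inv w)"
        using w vr[of k] inversions_iff[of "inv w" "- v k"] by (simp add: rho_simps uminus_pos_root)
      then show ?thesis by (intro UnI2 image_eqI[of _ _ "- v k"]) auto
    qed
  qed
  then have "finite (v ` ?C)" by (rule finite_subset) (use w in simp)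
  then have "finite ?C" using inj by (meson finite_imageD inj_on_subset subset_UNIV)
  then obtain K where K: "\<forall>k\<in>?C. k < K" using finite_nat_set_iff_bounded by blast
  have const: "v (K + n) \<in> pos_roots \<longleftrightarrow> v K \<in> pos_roots" for n
  proof (induct n)
    case (Suc n)
    have "K + n \<notin> ?C" using K by force
    then show ?case using Suc by simp
  qed simp
  \<comment> \<open>The common sign of the roots \<open>v k\<close> with \<open>k \<ge> K\<close>.\<close>
  define e where "e = (if v K \<in> pos_roots then 1 else - 1 :: real)"
  have "e * f (v (K + n)) > 0" for n
  proof (cases "v K \<in> pos_roots")
    case True
    then show ?thesis using const f(2) by (simp add: e_def)
  next
    case False
    then have "- v (K + n) \<in> pos_roots" using const vr uminus_pos_root by blast
    then have "f (- v (K + n)) > 0" using f(2) by blast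
    then show ?thesis using False f(1) by (simp add: e_def linear_neg)
  qed
  moreover have "e * f (v (K + Suc (Suc n))) = (4 * b\<^sup>2 - 2) * (e * f (v (K + Suc n))) - e * f (v (K + n))" for n
    unfolding add_Suc_right rec using f(1) by (simp add: linear_diff linear_scale right_diff_distrib)
  ultimately show False
    using no_positive_strictly_concave_sequence[of "\<lambda>n. e * f (v (K + n))" "4 * b\<^sup>2 - 2"] d by blast
qed

text \<open>
Sum a positive functional over the finite dihedral group generated by the two reflections.  The sum is
invariant under the group, so it vanishes on both roots; and it is positive on every positive root
that no member of the group makes negative.
\<close>
lemma functional_vanishing_on_two_roots:
  assumes "\<alpha>\<^sub>0 \<in> roots" "\<beta> \<in> roots" "\<bar>B \<alpha>\<^sub>0 \<beta>\<bar> < 1"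
  shows "\<exists>h :: 'v \<Rightarrow> real. linear h \<and> h \<alpha>\<^sub>0 = 0 \<and> h \<beta> = 0 \<and> finite {\<gamma> \<in> pos_roots. h \<gamma> \<le> 0}"
proof -
  obtain ra where ra: "ra \<in> carrier W" "\<And>x. \<rho> ra x = x - (2 * B \<alpha>\<^sub>0 x) *\<^sub>R \<alpha>\<^sub>0"
    using root_reflection assms(1) by metis
  obtain rb where rb: "rb \<in> carrier W" "\<And>x. \<rho> rb x = x - (2 * B \<beta> x) *\<^sub>R \<beta>"
    using root_reflection assms(2) by metis
  define w where "w = ra \<otimes> rb"
  have w: "w \<in> carrier W" using ra rb by (simp add: w_def)
  obtain m :: nat where m: "m > 0" "\<rho> (w [^] m) \<beta> = \<beta>"
    using rotation_finite_order[OF assms ra rb] unfolding w_def by blast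
  obtain f :: "'v \<Rightarrow> real" where f: "linear f" "\<forall>\<beta>\<in>pos_roots. f \<beta> > 0"
    using positive_functional by blast
  \<comment> \<open>The elements \<open>w\<^sup>i\<close> and \<open>w\<^sup>i r\<close>, with \<open>r\<close> the reflection in \<open>\<alpha>\<^sub>0\<close>, make up the dihedral group.\<close>
  define h where "h v = (\<Sum>i<m. f (\<rho> (w [^] i) v) + f (\<rho> (w [^] i) (\<rho> ra v)))" for v
  have "linear h"
    by (intro linearI)
      (simp_all add: h_def rho_simps w ra(1) linear_add[OF f(1)] linear_scale[OF f(1)] sum.distrib
        sum_distrib_left distrib_left)
  moreover have "\<rho> ra \<alpha>\<^sub>0 = - \<alpha>\<^sub>0" using root_unit[OF assms(1)] by (simp add: ra(2) scaleR_2)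
  then have "h \<alpha>\<^sub>0 = 0" unfolding h_def using w f(1) by (simp add: rho_simps linear_neg)
  moreover have "h \<beta> = 0"
  proof -
    have "\<rho> rb \<beta> = - \<beta>" using root_unit[OF assms(2)] by (simp add: rb(2) scaleR_2)
    then have "\<rho> w \<beta> = - \<rho> ra \<beta>" using ra(1) rb(1) by (simp add: w_def rho_simps)
    then have r: "\<rho> ra \<beta> = - \<rho> w \<beta>" by simp
    have "\<rho> (w [^] i) (\<rho> ra \<beta>) = - \<rho> (w [^] Suc i) \<beta>" for i unfolding r using w by (simp add: rho_simps)
    then have "h \<beta> = (\<Sum>i<m. f (\<rho> (w [^] i) \<beta>) - f (\<rho> (w [^] Suc i) \<beta>))"
      unfolding h_def using f(1) by (simp add: linear_neg)
    also have "\<dots> = f (\<rho> (w [^] (0::nat)) \<beta>) - f (\<rho> (w [^] m) \<beta>)" by (rule sum_lessThan_telescope')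
    finally show ?thesis using m by simp
  qed
  moreover have "finite {\<gamma> \<in> pos_roots. h \<gamma> \<le> 0}"
  proof -
    let ?U = "(\<lambda>i. w [^] i) ` {..<m} \<union> (\<lambda>i. w [^] i \<otimes> ra) ` {..<m}"
    have UW: "?U \<subseteq> carrier W" using w ra by auto
    have "{\<gamma> \<in> pos_roots. h \<gamma> \<le> 0} \<subseteq> (\<Union>u\<in>?U. inversions (inv u))"
    proof (rule subsetI, rule ccontr)
      fix \<gamma> assume g: "\<gamma> \<in> {\<gamma> \<in> pos_roots. h \<gamma> \<le> 0}" and n: "\<gamma> \<notin> (\<Union>u\<in>?U. inversions (inv u))"
      have p: "\<rho> u \<gamma> \<in> pos_roots" if u: "u \<in> ?U" for u
      proof -
        have "u \<in> carrier W" "\<gamma> \<notin> inversions (inv u)" using u UW n by blast+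
        then show ?thesis using g inversions_iff[of "inv u"] by simp
      qed
      have "f (\<rho> (w [^] i) \<gamma>) + f (\<rho> (w [^] i) (\<rho> ra \<gamma>)) > 0" if i: "i < m" for i
      proof -
        have "\<rho> (w [^] i) \<gamma> \<in> pos_roots" using p[of "w [^] i"] i by blast
        moreover have "\<rho> (w [^] i \<otimes> ra) \<gamma> \<in> pos_roots" using p[of "w [^] i \<otimes> ra"] i by blast
        then have "\<rho> (w [^] i) (\<rho> ra \<gamma>) \<in> pos_roots" using w ra(1) by simp
        ultimately show ?thesis using f(2) by (intro add_pos_pos) auto
      qed
      then have "h \<gamma> > 0" unfolding h_def using m by (intro sum_pos) auto
      then show False using g by simp
    qed
    moreover have "finite (\<Union>u\<in>?U. inversions (inv u))" using UW by (intro finite_UN_I) auto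
    ultimately show ?thesis by (rule finite_subset)
  qed
  ultimately show ?thesis by blast
qed

text \<open>
A functional that is positive on almost all positive roots lies in the Tits cone, and can be moved
into the closed fundamental chamber: as long as it is negative on a simple root, reflecting in that root
lowers the number of positive roots on which it is negative.
\<close>
lemma functional_chamber:
  fixes h :: "'v \<Rightarrow> real"
  assumes h: "linear h" and fin: "finite {\<gamma> \<in> pos_roots. h \<gamma> \<le> 0}"
  shows "\<exists>x\<in>carrier W. (\<forall>s\<in>S. h (\<rho> x (\<alpha> s)) \<ge> 0) \<and> finite {\<gamma> \<in> pos_roots. h (\<rho> x \<gamma>) \<le> 0}"
proof -
  have finZ: "finite {\<gamma> \<in> pos_roots. h (\<rho> x \<gamma>) \<le> 0}" if x: "x \<in> carrier W" for x
  proof -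
    have "{\<gamma> \<in> pos_roots. h (\<rho> x \<gamma>) \<le> 0} \<subseteq> \<rho> (inv x) ` {\<gamma> \<in> pos_roots. h \<gamma> \<le> 0} \<union> inversions (inv x)"
    proof
      fix \<gamma> assume g: "\<gamma> \<in> {\<gamma> \<in> pos_roots. h (\<rho> x \<gamma>) \<le> 0}"
      show "\<gamma> \<in> \<rho> (inv x) ` {\<gamma> \<in> pos_roots. h \<gamma> \<le> 0} \<union> inversions (inv x)"
      proof (cases "\<rho> x \<gamma> \<in> pos_roots")
        case True
        then have "\<gamma> = \<rho> (inv x) (\<rho> x \<gamma>)" "\<rho> x \<gamma> \<in> {\<gamma> \<in> pos_roots. h \<gamma> \<le> 0}" using g x by auto
        then show ?thesis by blast
      next
        case False
        then have "\<gamma> \<in> inversions (inv x)" using g x inversions_iff[of "inv x"] by simp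
        then show ?thesis by blast
      qed
    qed
    then show ?thesis by (rule finite_subset) (use fin x in simp)
  qed
  \<comment> \<open>The quantity to be minimised is the cardinality of this set.\<close>
  define M where "M x = {\<gamma> \<in> pos_roots. h (\<rho> x \<gamma>) < 0}" for x
  have finM: "finite (M x)" if "x \<in> carrier W" for x
    by (rule finite_subset[OF _ finZ[OF that]]) (auto simp: M_def)
  obtain x where x: "x \<in> carrier W" "\<And>y. y \<in> carrier W \<Longrightarrow> card (M x) \<le> card (M y)"
    using ex_has_least_nat[of "\<lambda>x. x \<in> carrier W" \<one> "\<lambda>x. card (M x)"] by auto
  have "h (\<rho> x (\<alpha> s)) \<ge> 0" if s: "s \<in> S" for s
  proof (rule ccontr)
    assume neg: "\<not> ?thesis"
    have "\<rho> s ` M (x \<otimes> s) \<subseteq> M x - {\<alpha> s}"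
    proof (rule image_subsetI)
      fix \<gamma> assume "\<gamma> \<in> M (x \<otimes> s)"
      then have g: "\<gamma> \<in> pos_roots" "h (\<rho> x (\<rho> s \<gamma>)) < 0" using x s by (auto simp: M_def)
      have ne: "\<gamma> \<noteq> \<alpha> s"
      proof
        assume "\<gamma> = \<alpha> s"
        then show False using g(2) neg x s h by (simp add: rho_simps linear_neg)
      qed
      then have "\<rho> s \<gamma> \<in> pos_roots" using simple_reflection_pos_root g s by blast
      moreover have "\<rho> s \<gamma> \<noteq> \<alpha> s"
      proof
        assume "\<rho> s \<gamma> = \<alpha> s"
        then have "\<gamma> = - \<alpha> s" using s by (metis rho_gen_gen rho_simple)
        then show False using g(1) s by (simp add: uminus_pos_root)
      qed
      ultimately show "\<rho> s \<gamma> \<in> M x - {\<alpha> s}" using g by (simp add: M_def)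
    qed
    moreover have "inj_on (\<rho> s) (M (x \<otimes> s))" using s by (intro inj_onI) simp
    ultimately have "card (M (x \<otimes> s)) \<le> card (M x - {\<alpha> s})" using finM[OF x(1)] by (intro card_inj_on_le) auto
    also have "\<dots> < card (M x)" using neg s finM[OF x(1)] by (intro card_Diff1_less) (auto simp: M_def)
    finally show False using x(2)[of "x \<otimes> s"] x(1) s by simp
  qed
  then show ?thesis using x(1) finZ by blast
qed

definition parabolic_roots :: "'a set \<Rightarrow> 'v set" where
  "parabolic_roots I = roots \<inter> (nonneg_cone (\<alpha> ` I) \<union> uminus ` nonneg_cone (\<alpha> ` I))"

lemma pos_root_functional_zero:
  fixes h :: "'v \<Rightarrow> real"
  assumes "linear h" "\<forall>s\<in>S. h (\<alpha> s) \<ge> 0" "\<gamma> \<in> pos_roots" "h \<gamma> = 0"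
  shows "\<gamma> \<in> nonneg_cone (\<alpha> ` {s \<in> S. h (\<alpha> s) = 0})"
proof -
  obtain c where c: "\<forall>s\<in>S. (c s :: real) \<ge> 0" "\<gamma> = (\<Sum>s\<in>S. c s *\<^sub>R \<alpha> s)"
    using pos_root_cone[OF assms(3)] simple_cone_sum by auto
  have "(\<Sum>s\<in>S. c s * h (\<alpha> s)) = 0" using assms(1,4) c(2) by (simp add: linear_sum linear_scale)
  then have z: "\<forall>s\<in>S. c s * h (\<alpha> s) = 0"
    using c(1) assms(2) by (subst (asm) sum_nonneg_eq_0_iff) auto
  show ?thesis unfolding c(2)
  proof (rule nonneg_cone_sum)
    fix s assume s: "s \<in> S"
    show "c s *\<^sub>R \<alpha> s \<in> nonneg_cone (\<alpha> ` {s \<in> S. h (\<alpha> s) = 0})"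
    proof (cases "h (\<alpha> s) = 0")
      case True
      then show ?thesis using s c(1) by (intro nonneg_cone_scale nonneg_cone_base) auto
    next
      case False
      then have "c s = 0" using z s by auto
      then show ?thesis by simp
    qed
  qed
qed

text \<open>
Move the functional that vanishes on both roots into the fundamental chamber.  There its
zeros among the roots are those of a standard parabolic subsystem, which is finite because
the functional is positive on almost all positive roots.
\<close>
lemma form_value_in_finite_parabolic:
  assumes "\<alpha>\<^sub>0 \<in> roots" "\<beta> \<in> roots" "\<bar>B \<alpha>\<^sub>0 \<beta>\<bar> < 1"
  shows "\<exists>I\<subseteq>S. finite (parabolic_roots I) \<and> (\<exists>a\<in>parabolic_roots I. \<exists>b\<in>parabolic_roots I. B \<alpha>\<^sub>0 \<beta> = B a b)"
proof -
  obtain h0 :: "'v \<Rightarrow> real" where h0: "linear h0" "h0 \<alpha>\<^sub>0 = 0" "h0 \<beta> = 0" "finite {\<gamma> \<in> pos_roots. h0 \<gamma> \<le> 0}"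
    using functional_vanishing_on_two_roots[OF assms] by blast
  obtain x where x: "x \<in> carrier W" "\<forall>s\<in>S. h0 (\<rho> x (\<alpha> s)) \<ge> 0" "finite {\<gamma> \<in> pos_roots. h0 (\<rho> x \<gamma>) \<le> 0}"
    using functional_chamber[OF h0(1,4)] by blast
  define h where "h v = h0 (\<rho> x v)" for v
  have h: "linear h" unfolding h_def using linear_compose[OF rho_linear[OF x(1)] h0(1)] by (simp add: o_def)
  have h_nonneg: "\<forall>s\<in>S. h (\<alpha> s) \<ge> 0" using x(2) by (simp add: h_def)
  define I where "I = {s \<in> S. h (\<alpha> s) = 0}"
  have mem: "\<rho> (inv x) \<gamma> \<in> parabolic_roots I" if g: "\<gamma> \<in> roots" "h0 \<gamma> = 0" for \<gamma>
  proof -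
    let ?g = "\<rho> (inv x) \<gamma>"
    have r: "?g \<in> roots" using g x(1) by simp
    have z: "h ?g = 0" using g x(1) by (simp add: h_def)
    show ?thesis
    proof (cases "?g \<in> pos_roots")
      case True
      then have "?g \<in> nonneg_cone (\<alpha> ` I)" using pos_root_functional_zero[OF h h_nonneg _ z] by (simp add: I_def)
      then show ?thesis using r by (simp add: parabolic_roots_def)
    next
      case False
      then have "- ?g \<in> pos_roots" using r by (simp add: uminus_pos_root)
      moreover have "h (- ?g) = 0" using z h by (simp add: linear_neg)
      ultimately have "- ?g \<in> nonneg_cone (\<alpha> ` I)" using pos_root_functional_zero[OF h h_nonneg] by (simp add: I_def)
      then have "?g \<in> uminus ` nonneg_cone (\<alpha> ` I)" by (intro image_eqI[of _ _ "- ?g"]) auto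
      then show ?thesis using r by (simp add: parabolic_roots_def)
    qed
  qed
  have cone0: "\<gamma> \<in> {\<gamma> \<in> pos_roots. h0 (\<rho> x \<gamma>) \<le> 0}" if g: "\<gamma> \<in> roots" "\<gamma> \<in> nonneg_cone (\<alpha> ` I)" for \<gamma>
  proof -
    have "nonneg_cone (\<alpha> ` I) \<subseteq> {v. h v = 0}"
      by (rule nonneg_cone_least) (auto simp: I_def linear_0[OF h] linear_add[OF h] linear_scale[OF h])
    then have "h \<gamma> = 0" using g by auto
    moreover have "nonneg_cone (\<alpha> ` I) \<subseteq> simple_cone" by (rule nonneg_cone_mono) (auto simp: I_def)
    ultimately show ?thesis using g by (auto simp: pos_roots_iff h_def)
  qed
  have "parabolic_roots I \<subseteq> {\<gamma> \<in> pos_roots. h0 (\<rho> x \<gamma>) \<le> 0} \<union> uminus ` {\<gamma> \<in> pos_roots. h0 (\<rho> x \<gamma>) \<le> 0}"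
  proof
    fix \<gamma> assume "\<gamma> \<in> parabolic_roots I"
    then have g: "\<gamma> \<in> roots" "\<gamma> \<in> nonneg_cone (\<alpha> ` I) \<or> - \<gamma> \<in> nonneg_cone (\<alpha> ` I)"
      by (auto simp: parabolic_roots_def)
    from g(2) show "\<gamma> \<in> {\<gamma> \<in> pos_roots. h0 (\<rho> x \<gamma>) \<le> 0} \<union> uminus ` {\<gamma> \<in> pos_roots. h0 (\<rho> x \<gamma>) \<le> 0}"
    proof
      assume "\<gamma> \<in> nonneg_cone (\<alpha> ` I)"
      then show ?thesis using cone0[OF g(1)] by blast
    next
      assume "- \<gamma> \<in> nonneg_cone (\<alpha> ` I)"
      then have "- \<gamma> \<in> {\<gamma> \<in> pos_roots. h0 (\<rho> x \<gamma>) \<le> 0}" using cone0[of "- \<gamma>"] g(1) by simp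
      then show ?thesis by (intro UnI2 image_eqI[of _ _ "- \<gamma>"]) auto
    qed
  qed
  then have fin: "finite (parabolic_roots I)" by (rule finite_subset) (use x(3) in simp)
  have "B \<alpha>\<^sub>0 \<beta> = B (\<rho> (inv x) \<alpha>\<^sub>0) (\<rho> (inv x) \<beta>)" using x(1) by simp
  then have "\<exists>a\<in>parabolic_roots I. \<exists>b\<in>parabolic_roots I. B \<alpha>\<^sub>0 \<beta> = B a b"
    using mem[OF assms(1) h0(2)] mem[OF assms(2) h0(3)] by blast
  moreover have "I \<subseteq> S" unfolding I_def by blast
  ultimately show ?thesis using fin by blast
qed

theorem finite_form_values: "finite {B a b | a b. a \<in> roots \<and> b \<in> roots \<and> \<bar>B a b\<bar> < 1}"
proof (rule finite_subset)
  let ?Q = "{I. I \<subseteq> S \<and> finite (parabolic_roots I)}"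
  show "{B a b | a b. a \<in> roots \<and> b \<in> roots \<and> \<bar>B a b\<bar> < 1} \<subseteq>
      (\<Union>I\<in>?Q. (\<lambda>(a, b). B a b) ` (parabolic_roots I \<times> parabolic_roots I))"
  proof
    fix r assume "r \<in> {B a b | a b. a \<in> roots \<and> b \<in> roots \<and> \<bar>B a b\<bar> < 1}"
    then obtain a b where ab: "a \<in> roots" "b \<in> roots" "\<bar>B a b\<bar> < 1" "r = B a b" by blast
    obtain I c d where "I \<subseteq> S" "finite (parabolic_roots I)" "c \<in> parabolic_roots I" "d \<in> parabolic_roots I" "B a b = B c d"
      using form_value_in_finite_parabolic[OF ab(1-3)] by blast
    then show "r \<in> (\<Union>I\<in>?Q. (\<lambda>(a, b). B a b) ` (parabolic_roots I \<times> parabolic_roots I))"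
      using ab(4) by (intro UN_I[of I] image_eqI[of _ _ "(c, d)"]) auto
  qed
  have "finite ?Q" by (rule finite_subset[of _ "Pow S"]) auto
  then show "finite (\<Union>I\<in>?Q. (\<lambda>(a, b). B a b) ` (parabolic_roots I \<times> parabolic_roots I))"
    by (intro finite_UN_I) auto
qed

end

section \<open>Finiteness of the elementary roots\<close>

context geometric_representation
begin

text \<open>
Since \<open>B(\<alpha>\<^sub>s, \<beta>) < 0\<close>, a step from \<open>\<beta>\<close> to \<open>\<gamma>\<close> goes up: it adds a positive multiple of \<open>\<alpha>\<^sub>s\<close>.
\<close>
definition elementary_step :: "'a \<Rightarrow> 'v \<Rightarrow> 'v \<Rightarrow> bool" where
  "elementary_step s \<beta> \<gamma> \<longleftrightarrow> s \<in> S \<and> \<beta> \<in> elementary_roots \<and> \<gamma> \<in> elementary_roots \<and>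
     \<gamma> = \<rho> s \<beta> \<and> - 1 < B (\<alpha> s) \<beta> \<and> B (\<alpha> s) \<beta> < 0"

definition elementary_chain :: "nat \<Rightarrow> (nat \<Rightarrow> 'v) \<Rightarrow> bool" where
  "elementary_chain k b \<longleftrightarrow> (\<forall>i<k. \<exists>s. elementary_step s (b i) (b (Suc i)))"

lemma elementary_pos: "\<beta> \<in> elementary_roots \<Longrightarrow> \<beta> \<in> pos_roots"
  unfolding elementary_roots_def by simp

lemma elementary_form_lt:
  assumes "\<beta> \<in> elementary_roots" "\<gamma> \<in> elementary_roots" "B \<gamma> \<beta> \<ge> 1"
  shows "\<gamma> = \<beta>"
  using dominance_comparable[OF _ _ assms(3)] elementary_pos elementary_rootsD assms by metis

lemma simple_elementary: "s \<in> S \<Longrightarrow> \<alpha> s \<in> elementary_roots"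
proof -
  assume s: "s \<in> S"
  have "\<gamma> = \<alpha> s" if "dominance \<gamma> (\<alpha> s)" for \<gamma>
    using dominance_inversions[OF that, of s] s by simp
  then show ?thesis using s unfolding elementary_roots_def by (auto simp: dominated_iff)
qed

text \<open>
Since \<open>B(\<beta>, \<beta>) > 0\<close>, some simple root \<open>\<alpha>\<^sub>s\<close> has positive form value with \<open>\<beta>\<close>, and this value is less
than \<open>1\<close> because both roots are elementary.  A root other than \<open>s \<beta>\<close> that is dominated by \<open>s \<beta>\<close>
would be mapped by \<open>s\<close> to one dominated by \<open>\<beta>\<close>, unless it is \<open>\<alpha>\<^sub>s\<close>; but \<open>B(\<alpha>\<^sub>s, s \<beta>) < 0\<close>.
\<close>
lemma elementary_descend:
  assumes "\<beta> \<in> elementary_roots" "\<beta> \<notin> \<alpha> ` S"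
  shows "\<exists>s. elementary_step s (\<rho> s \<beta>) \<beta>"
proof -
  have bp: "\<beta> \<in> pos_roots" using assms elementary_pos by blast
  obtain c where c: "\<forall>s\<in>S. (c s :: real) \<ge> 0" "\<beta> = (\<Sum>s\<in>S. c s *\<^sub>R \<alpha> s)"
    using pos_root_cone[OF bp] simple_cone_sum by auto
  have "\<exists>s\<in>S. B (\<alpha> s) \<beta> > 0"
  proof (rule ccontr)
    assume n: "\<not> ?thesis"
    have "B \<beta> \<beta> = (\<Sum>s\<in>S. c s * B (\<alpha> s) \<beta>)" by (subst (1) c(2)) (simp add: form_simps)
    also have "\<dots> \<le> 0" using n c(1) by (intro sum_nonpos mult_nonneg_nonpos) (auto simp: not_less)
    finally show False using root_unit[of \<beta>] bp by simp
  qed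
  then obtain s where s: "s \<in> S" "B (\<alpha> s) \<beta> > 0" by blast
  have ne: "\<beta> \<noteq> \<alpha> s" using assms(2) s by blast
  then have lt: "B (\<alpha> s) \<beta> < 1" using elementary_form_lt[OF assms(1) simple_elementary[OF s(1)]] by force
  have p: "\<rho> s \<beta> \<in> pos_roots" using simple_reflection_pos_root[OF s(1) bp ne] .
  have form: "B (\<alpha> s) (\<rho> s \<beta>) = - B (\<alpha> s) \<beta>" using s by (simp add: reflection form_simps)
  have "\<gamma> = \<rho> s \<beta>" if d: "dominance \<gamma> (\<rho> s \<beta>)" for \<gamma>
  proof -
    have gp: "\<gamma> \<in> pos_roots" using dominance_pos_roots[OF d] by blast
    have "\<gamma> \<noteq> \<alpha> s" using dominance_form_pos[OF d] form s by auto
    then have sg: "\<rho> s \<gamma> \<in> pos_roots" using simple_reflection_pos_root[OF s(1) gp] by blast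
    have "\<rho> w (\<rho> s \<gamma>) \<notin> pos_roots" if w: "w \<in> carrier W" "\<rho> w \<beta> \<notin> pos_roots" for w
    proof -
      have ws: "w \<otimes> s \<in> carrier W" using w s by simp
      have "\<rho> (w \<otimes> s) (\<rho> s \<beta>) \<notin> pos_roots" using w s by simp
      then have "\<rho> (w \<otimes> s) \<gamma> \<notin> pos_roots" using d ws unfolding dominance_iff by blast
      then show ?thesis using w s by simp
    qed
    then have "dominance (\<rho> s \<gamma>) \<beta>" using sg bp unfolding dominance_iff by blast
    then have "\<rho> s \<gamma> = \<beta>" using elementary_rootsD[OF assms(1)] by blast
    then show ?thesis using s by (metis rho_gen_gen)
  qed
  then have "\<rho> s \<beta> \<in> elementary_roots" using p unfolding elementary_roots_def by (auto simp: dominated_iff)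
  then show ?thesis unfolding elementary_step_def using s form lt assms(1) by (intro exI[of _ s]) simp
qed

text \<open>
The record of \<open>\<beta>\<close>: its form values with the simple roots, where \<open>None\<close> stands for every value
at most \<open>-1\<close>.  Restriction to \<open>S\<close> makes the set of possible records finite.
\<close>
definition chain_state :: "'v \<Rightarrow> 'a \<Rightarrow> real option" where
  "chain_state \<beta> = (\<lambda>t\<in>S. if B (\<alpha> t) \<beta> \<le> - 1 then None else Some (B (\<alpha> t) \<beta>))"

text \<open>
A step with \<open>s\<close> adds a positive multiple of \<open>\<alpha>\<^sub>s\<close>, which can increase only the form value with \<open>\<alpha>\<^sub>s\<close>;
and \<open>t\<close> itself is not eligible for a step while its value is at most \<open>-1\<close>.
\<close>
lemma elementary_chain_stays_dead:
  assumes chain: "elementary_chain k b" and "i \<le> l" "l \<le> k" and t: "t \<in> S" "B (\<alpha> t) (b i) \<le> - 1"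
  shows "B (\<alpha> t) (b l) \<le> - 1"
  using \<open>i \<le> l\<close> \<open>l \<le> k\<close>
proof (induct l rule: dec_induct)
  case (step n)
  then have "n < k" by simp
  then obtain s where s: "elementary_step s (b n) (b (Suc n))" using chain unfolding elementary_chain_def by blast
  have IH: "B (\<alpha> t) (b n) \<le> - 1" using step by simp
  have sS: "s \<in> S" "b (Suc n) = \<rho> s (b n)" "- 1 < B (\<alpha> s) (b n)" "B (\<alpha> s) (b n) < 0"
    using s unfolding elementary_step_def by auto
  have "t \<noteq> s" using IH sS by auto
  then have "B (\<alpha> t) (\<alpha> s) \<le> 0" using simple_form_nonpos t sS by blast
  then have "B (\<alpha> s) (b n) * B (\<alpha> t) (\<alpha> s) \<ge> 0" using sS(4) by (intro mult_nonpos_nonpos) auto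
  moreover have "B (\<alpha> t) (b (Suc n)) = B (\<alpha> t) (b n) - 2 * (B (\<alpha> s) (b n) * B (\<alpha> t) (\<alpha> s))"
    using sS by (simp add: reflection form_simps)
  ultimately show ?case using IH by simp
qed (use t in simp)

text \<open>
Let \<open>\<delta>\<close> be the difference of two members with equal records.  The generators used in between were
not dead, so their form values are recorded and agree: \<open>\<delta>\<close> is orthogonal to the simple roots
it is composed of.  So \<open>\<delta>\<close> is isotropic, and the two unit vectors have form value \<open>1\<close>, which
forces them to be equal although \<open>\<delta>\<close> has positive height.
\<close>
lemma elementary_chain_state_inj:
  assumes chain: "elementary_chain k b" and ij: "i < j" "j \<le> k"
  shows "chain_state (b i) \<noteq> chain_state (b j)"
proof
  assume eq: "chain_state (b i) = chain_state (b j)"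
  have "\<exists>s. elementary_step s (b l) (b (Suc l))" if "l < k" for l
    using chain that unfolding elementary_chain_def by blast
  then obtain s where s: "\<And>l. l < k \<Longrightarrow> elementary_step (s l) (b l) (b (Suc l))" by metis
  define c where "c l = - 2 * B (\<alpha> (s l)) (b l)" for l
  have step: "s l \<in> S" "b (Suc l) = b l + c l *\<^sub>R \<alpha> (s l)" "c l > 0" "- 1 < B (\<alpha> (s l)) (b l)" if "l < k" for l
    using s[OF that] unfolding elementary_step_def by (auto simp: reflection c_def)
  have diff: "b (i + n) - b i = (\<Sum>l=i..<i+n. c l *\<^sub>R \<alpha> (s l))" if "i + n \<le> k" for n
    using that
  proof (induct n)
    case (Suc n)
    then show ?case using step(2)[of "i + n"] by (simp add: algebra_simps)
  qed simp
  define \<delta> where "\<delta> = b j - b i"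
  have \<delta>: "\<delta> = (\<Sum>l=i..<j. c l *\<^sub>R \<alpha> (s l))" unfolding \<delta>_def using diff[of "j - i"] ij by simp
  have orth: "B (\<alpha> (s l)) \<delta> = 0" if l: "l \<in> {i..<j}" for l
  proof -
    have lk: "l < k" "i \<le> l" using l ij by auto
    have sS: "s l \<in> S" using step lk by blast
    have "\<not> B (\<alpha> (s l)) (b i) \<le> - 1"
      using elementary_chain_stays_dead[OF chain lk(2) _ sS] step(4)[OF lk(1)] lk by force
    moreover have "chain_state (b i) (s l) = chain_state (b j) (s l)" using eq by simp
    ultimately have "B (\<alpha> (s l)) (b i) = B (\<alpha> (s l)) (b j)"
      using sS by (simp add: chain_state_def split: if_splits)
    then show ?thesis by (simp add: \<delta>_def form_simps)
  qed
  have "B \<delta> \<delta> = (\<Sum>l=i..<j. c l * B (\<alpha> (s l)) \<delta>)" by (subst (1) \<delta>) (simp add: form_simps)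
  also have "\<dots> = 0" using orth by (intro sum.neutral) simp
  finally have "B \<delta> \<delta> = 0" .
  have el: "b l \<in> elementary_roots" if "l \<le> k" for l
  proof (cases "l < k")
    case True
    then show ?thesis using s[OF True] unfolding elementary_step_def by blast
  next
    case False
    then have "l = Suc (k - 1)" "k - 1 < k" using that ij by auto
    then show ?thesis using s[of "k - 1"] unfolding elementary_step_def by metis
  qed
  have unit: "B (b i) (b i) = 1" "B (b j) (b j) = 1" using el ij elementary_pos root_unit by auto
  have bj: "b j = b i + \<delta>" by (simp add: \<delta>_def)
  have "B (b j) (b j) = 1 + 2 * B (b i) \<delta>"
    unfolding bj using unit \<open>B \<delta> \<delta> = 0\<close> form(2)[of \<delta> "b i"] by (simp add: form_simps)
  then have "B (b i) \<delta> = 0" using unit by simp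
  then have "B (b i) (b j) \<ge> 1" unfolding bj using unit by (simp add: form_simps)
  then have "b i = b j" using elementary_form_lt[of "b j" "b i"] el ij by simp
  then have "\<delta> = 0" by (simp add: \<delta>_def)
  obtain f :: "'v \<Rightarrow> real" where f: "linear f" "\<forall>\<beta>\<in>pos_roots. f \<beta> > 0"
    using positive_functional by blast
  have "f \<delta> = (\<Sum>l=i..<j. c l * f (\<alpha> (s l)))" unfolding \<delta> using f(1) by (simp add: linear_sum linear_scale)
  also have "\<dots> > 0"
  proof (rule sum_pos)
    fix l assume "l \<in> {i..<j}"
    then have "l < k" using ij by auto
    then show "c l * f (\<alpha> (s l)) > 0" using step f(2) by (intro mult_pos_pos) auto
  qed (use ij in auto)
  finally show False using \<open>\<delta> = 0\<close> f(1) by (simp add: linear_0)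
qed

lemma elementary_chain_elements:
  "elementary_chain (Suc k) b \<Longrightarrow> i \<le> Suc k \<Longrightarrow> b i \<in> elementary_roots"
  unfolding elementary_chain_def elementary_step_def
  by (cases i) (auto simp: less_Suc_eq_le)

theorem elementary_chain_bounded: "\<exists>K. \<forall>k b. elementary_chain k b \<longrightarrow> k < K"
proof -
  define F where "F = insert None (Some ` insert 1 {B a b | a b. a \<in> roots \<and> b \<in> roots \<and> \<bar>B a b\<bar> < 1})"
  have finF: "finite F" unfolding F_def using finite_form_values by simp
  let ?X = "S \<rightarrow>\<^sub>E F"
  have finX: "finite ?X" using finF by (intro finite_PiE) auto
  have state: "chain_state \<beta> \<in> ?X" if b: "\<beta> \<in> elementary_roots" for \<beta>
  proof
    fix t assume t: "t \<in> S"
    have "B (\<alpha> t) \<beta> = 1" if "B (\<alpha> t) \<beta> \<ge> 1"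
      using elementary_form_lt[OF b simple_elementary[OF t] that] t by auto
    moreover have "B (\<alpha> t) \<beta> \<in> {B a b | a b. a \<in> roots \<and> b \<in> roots \<and> \<bar>B a b\<bar> < 1}" if "\<bar>B (\<alpha> t) \<beta>\<bar> < 1"
      using that t elementary_pos[OF b] simple_root[OF t] pos_root by blast
    ultimately show "chain_state \<beta> t \<in> F"
      using t unfolding chain_state_def F_def by (cases "B (\<alpha> t) \<beta> \<ge> 1") (simp_all add: abs_less_iff)
  qed (simp add: chain_state_def)
  have "k < Suc (card ?X)" if chain: "elementary_chain k b" for k b
  proof (cases k)
    case (Suc m)
    have "inj_on (\<lambda>i. chain_state (b i)) {..k}"
      using elementary_chain_state_inj[OF chain] by (intro linorder_inj_onI) auto
    moreover have "(\<lambda>i. chain_state (b i)) ` {..k} \<subseteq> ?X"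
    proof (rule image_subsetI)
      fix i assume "i \<in> {..k}"
      then show "chain_state (b i) \<in> ?X"
        using state elementary_chain_elements[of m b i] chain Suc by simp
    qed
    ultimately have "card {..k} \<le> card ?X" using finX by (intro card_inj_on_le)
    then show ?thesis by simp
  qed simp
  then show ?thesis by blast
qed

fun root_layer :: "nat \<Rightarrow> 'v set" where
  "root_layer 0 = \<alpha> ` S"
| "root_layer (Suc n) = root_layer n \<union> (\<Union>s\<in>S. \<rho> s ` root_layer n)"

lemma finite_root_layer: "finite (root_layer n)"
  by (induct n) auto

lemma simple_in_root_layer: "\<alpha> ` S \<subseteq> root_layer n"
  by (induct n) auto

text \<open>
Descend from \<open>\<beta>\<close> as long as the root is not simple.  Either a simple root is reached within \<open>n\<close>
steps or the descent is a chain with more than \<open>n\<close> steps.  The bound on chains therefore also shows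
that the descent ends.
\<close>
lemma elementary_layer_or_chain:
  assumes "\<beta> \<in> elementary_roots"
  shows "\<beta> \<in> root_layer n \<or> (\<exists>b. elementary_chain (Suc n) b \<and> b (Suc n) = \<beta>)"
  using assms
proof (induct n arbitrary: \<beta>)
  case 0
  show ?case
  proof (cases "\<beta> \<in> \<alpha> ` S")
    case False
    then obtain s where "elementary_step s (\<rho> s \<beta>) \<beta>" using elementary_descend 0 by blast
    then have "elementary_chain (Suc 0) (\<lambda>i. if i = 0 then \<rho> s \<beta> else \<beta>)"
      unfolding elementary_chain_def by auto
    then show ?thesis by (intro disjI2 exI[of _ "\<lambda>i. if i = 0 then \<rho> s \<beta> else \<beta>"]) simp
  qed simp
next
  case (Suc n)
  show ?case
  proof (cases "\<beta> \<in> \<alpha> ` S")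
    case True
    then show ?thesis using simple_in_root_layer by blast
  next
    case False
    then obtain s where s: "elementary_step s (\<rho> s \<beta>) \<beta>" using elementary_descend Suc.prems by blast
    then have e: "s \<in> S" "\<rho> s \<beta> \<in> elementary_roots" unfolding elementary_step_def by auto
    from Suc.hyps[OF e(2)] show ?thesis
    proof
      assume "\<rho> s \<beta> \<in> root_layer n"
      then have "\<rho> s (\<rho> s \<beta>) \<in> \<rho> s ` root_layer n" by (rule imageI)
      then have "\<beta> \<in> \<rho> s ` root_layer n" unfolding rho_gen_gen[OF e(1)] .
      then show ?thesis using e(1) by auto
    next
      assume "\<exists>b. elementary_chain (Suc n) b \<and> b (Suc n) = \<rho> s \<beta>"
      then obtain b where b: "elementary_chain (Suc n) b" "b (Suc n) = \<rho> s \<beta>" by blast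
      define b' where "b' i = (if i \<le> Suc n then b i else \<beta>)" for i
      have "elementary_chain (Suc (Suc n)) b'" unfolding elementary_chain_def
      proof (intro allI impI)
        fix i assume "i < Suc (Suc n)"
        then consider "i < Suc n" | "i = Suc n" by linarith
        then show "\<exists>s. elementary_step s (b' i) (b' (Suc i))"
        proof cases
          case 1
          then show ?thesis using b(1) unfolding elementary_chain_def b'_def by auto
        next
          case 2
          then show ?thesis using b(2) s unfolding b'_def by auto
        qed
      qed
      then show ?thesis unfolding b'_def by (intro disjI2 exI[of _ b']) (simp add: b'_def[abs_def])
    qed
  qed
qed

theorem finite_elementary_roots: "finite elementary_roots"
proof -
  obtain K where K: "\<And>k b. elementary_chain k b \<Longrightarrow> k < K" using elementary_chain_bounded by blast
  have "elementary_roots \<subseteq> root_layer K"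
  proof
    fix \<beta> assume "\<beta> \<in> elementary_roots"
    then show "\<beta> \<in> root_layer K" using elementary_layer_or_chain[of \<beta> K] K[of "Suc K"] by force
  qed
  then show ?thesis using finite_root_layer by (rule finite_subset)
qed

theorem finite_small_roots: "finite (small_roots n)"
  using finite_small_roots_if_finite_elementary finite_elementary_roots .

end

section \<open>Low elements\<close>

context geometric_representation
begin

lemma root_cone_single: "s \<in> S \<Longrightarrow> root_cone {\<alpha> s} = {\<alpha> s}"
proof
  assume s: "s \<in> S"
  show "root_cone {\<alpha> s} \<subseteq> {\<alpha> s}" using inversions_convex[of s "{\<alpha> s}"] s by simp
  show "{\<alpha> s} \<subseteq> root_cone {\<alpha> s}" using s by (intro root_cone_base) simp
qed

lemma gens_low: "s \<in> S \<Longrightarrow> s \<in> low_elements n"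
proof -
  assume s: "s \<in> S"
  have "dominated (\<alpha> s) = {}" using simple_elementary[OF s] unfolding elementary_roots_def by simp
  then have "{\<alpha> s} \<subseteq> small_roots n" using s by (simp add: small_roots_iff)
  then show ?thesis unfolding low_elements_def using s root_cone_single[OF s] by auto
qed

lemma one_low: "\<one> \<in> low_elements n"
  unfolding low_elements_def by (auto intro!: exI[of _ "{}"])

lemma low_carrier: "w \<in> low_elements n \<Longrightarrow> w \<in> carrier W"
  unfolding low_elements_def by simp

text \<open>
A set \<open>A\<close> of \<open>n\<close>-small roots that spans \<open>N(w)\<close> lies in \<open>N(w)\<close>, so it can be enlarged to
\<open>\<Sigma>\<^sub>n(w)\<close>; convexity of \<open>N(w)\<close> prevents the cone from growing.
\<close>
lemma low_inversions:
  assumes "w \<in> low_elements n"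
  shows "inversions w = root_cone (small_inversions n w)"
proof
  obtain A where A: "A \<subseteq> small_roots n" "inversions w = root_cone A" using assms unfolding low_elements_def by blast
  have "A \<subseteq> roots" using A(1) by (auto simp: small_roots_iff)
  then have "A \<subseteq> small_inversions n w" using A root_cone_base unfolding small_inversions_def by blast
  then show "inversions w \<subseteq> root_cone (small_inversions n w)" unfolding A(2) by (rule root_cone_mono)
  show "root_cone (small_inversions n w) \<subseteq> inversions w"
    using low_carrier[OF assms] by (rule inversions_convex) (simp add: small_inversions_def)
qed

lemma small_inversions_inj: "inj_on (small_inversions n) (low_elements n)"
proof (rule inj_onI)
  fix u w assume uw: "u \<in> low_elements n" "w \<in> low_elements n" "small_inversions n u = small_inversions n w"
  then have "inversions u = inversions w" using low_inversions by metis
  then show "u = w" using inversions_inj low_carrier uw by blast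
qed

lemma finite_low_elements: "finite (low_elements n)"
proof (rule finite_imageD[OF _ small_inversions_inj])
  have "small_inversions n ` low_elements n \<subseteq> Pow (small_roots n)" by (auto simp: small_inversions_def)
  then show "finite (small_inversions n ` low_elements n)"
    by (rule finite_subset) (simp add: finite_small_roots)
qed

lemma low_join:
  assumes "X \<subseteq> low_elements n" "weakly_bounded X"
  shows "\<Squnion>\<^bsub>weak_order\<^esub> X \<in> low_elements n"
proof -
  let ?A = "\<Union>x\<in>X. small_inversions n x"
  have "root_cone (\<Union>x\<in>X. inversions x) = root_cone ?A"
  proof
    have "inversions x \<subseteq> nonneg_cone ?A" if "x \<in> X" for x
    proof -
      have "inversions x = root_cone (small_inversions n x)" using low_inversions assms(1) that by blast
      also have "\<dots> \<subseteq> nonneg_cone (small_inversions n x)" unfolding root_cone_def by simp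
      also have "\<dots> \<subseteq> nonneg_cone ?A" by (rule nonneg_cone_mono) (use that in blast)
      finally show ?thesis .
    qed
    then show "root_cone (\<Union>x\<in>X. inversions x) \<subseteq> root_cone ?A" by (intro root_cone_subset_cone) blast
    show "root_cone ?A \<subseteq> root_cone (\<Union>x\<in>X. inversions x)"
      by (rule root_cone_mono) (auto simp: small_inversions_def)
  qed
  moreover have "?A \<subseteq> small_roots n" by (auto simp: small_inversions_def)
  ultimately show ?thesis using inversions_join[OF assms(2)] unfolding low_elements_def by auto
qed

end

theorem proposition3p26:
  fixes W :: "('a, 'm) monoid_scheme"
    and S :: "'a set"
    and B :: "'v::real_vector \<Rightarrow> 'v \<Rightarrow> real"
    and \<alpha> :: "'a \<Rightarrow> 'v"
    and \<rho> :: "'a \<Rightarrow> 'v \<Rightarrow> 'v"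
    and n :: nat
  assumes "coxeter_system W S"
    and "finite S"
    and "geometric_representation W S B \<alpha> \<rho>"
  shows "S \<union> {\<one>\<^bsub>W\<^esub>} \<subseteq> geometric_representation.low_elements W S \<alpha> \<rho> n
    \<and> (geometric_representation.small_inversions W S \<alpha> \<rho> n
           \<in> geometric_representation.low_elements W S \<alpha> \<rho> n
             \<rightarrow> geometric_representation.small_inversion_sets W S \<alpha> \<rho> n
         \<and> inj_on (geometric_representation.small_inversions W S \<alpha> \<rho> n)
              (geometric_representation.low_elements W S \<alpha> \<rho> n))
    \<and> (finite (geometric_representation.low_elements W S \<alpha> \<rho> n)
         \<and> (\<forall>X. X \<subseteq> geometric_representation.low_elements W S \<alpha> \<rho> n \<longrightarrow>
               coxeter_system.weakly_bounded W S X \<longrightarrow>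
               \<Squnion>\<^bsub>coxeter_system.weak_order W S\<^esub> X
                 \<in> geometric_representation.low_elements W S \<alpha> \<rho> n))"
proof -
  interpret geometric_representation W S B \<alpha> \<rho> by (rule assms(3))
  have "small_inversions n \<in> low_elements n \<rightarrow> small_inversion_sets n"
    unfolding small_inversion_sets_def using low_carrier by auto
  then show ?thesis
    using gens_low one_low small_inversions_inj finite_low_elements low_join by blast
qed

end
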